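(* Let $n\ge 1$. There are subsets $\mathcal{B}_1\subseteq\mathcal{B}_2\subseteq\dots\subseteq\mathcal{B}_n\subseteq\mathcal{P}_T(\mathbb{Z}^n)$ such that (1) for every pure subgroup $G\subseteq\mathbb{Z}^n$ and every $1\le m\le n$, the set $\mathcal{B}_m\cap\mathcal{P}_T(G)$ is a basis of the free abelian group $\mathcal{P}_T^m(G)$; (2) for every $1\le m\le n$ (with $\mathcal{B}_0=\emptyset$), every element of $\mathcal{B}_m\setminus\mathcal{B}_{m-1}$ is the class of an integral polytope of dimension exactly $m$. In particular $\mathcal{B}_n$ is a basis of $\mathcal{P}_T(\mathbb{Z}^n)$. Moreover, if $\mathcal{A}\subseteq\mathbb{Z}^n$ is a basis of $\mathbb{Z}^n$ and $\mathcal{B}_n'\subseteq\mathcal{P}(\mathbb{Z}^n)$ is a set of representatives (lifts) of the elements of $\mathcal{B}_n$, then $\{\{a\}: a\in\mathcal{A}\}\cup\mathcal{B}_n'$ is a basis of $\mathcal{P}(\mathbb{Z}^n)$.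
   Context: A polytope in a finite-dimensional real vector space $V$ is the convex hull of a nonempty finite set; its dimension is that of the smallest affine subspace containing it. Polytopes form a commutative cancellative monoid under Minkowski sum $P+Q=\{p+q\}$, and $\mathcal{P}(V)$ denotes its Grothendieck group (the class of $P$ is again written $P$). For a finitely generated free abelian group $H$, put $V_H=H\otimes_{\mathbb{Z}}\mathbb{R}$; a polytope in $V_H$ is integral if it is the convex hull of finitely many points of $H$. $\mathcal{P}(H)\subseteq\mathcal{P}(V_H)$ is the Grothendieck group of the monoid of integral polytopes, and $\mathcal{P}_T(H)$ is the cokernel of the homomorphism $H\to\mathcal{P}(H)$, $h\mapsto\{h\}$ (so two integral polytopes have the same class in $\mathcal{P}_T(H)$ iff they are translates). For a subgroup $G\subseteq H$, $\mathcal{P}(G)$ and $\mathcal{P}_T(G)$ are regarded as subgroups of $\mathcal{P}(H)$, $\mathcal{P}_T(H)$ via the induced injective maps. $\mathcal{P}_T^m(G)$ is the subgroup of $\mathcal{P}_T(G)$ generated by classes of integral polytopes (in $G$) of dimension at most $m$. A subgroup $G\subseteq H$ is pure if $G=U\cap H$ for some linear subspace $U\subseteq V_H$. *)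

theory Defs
  imports "HOL-Analysis.Analysis" "HOL-Algebra.Generated_Groups" "HOL-Algebra.FiniteProduct"
begin

definition zlat :: "(real^'n::finite) set" where
  "zlat = {x. \<forall>i. x $ i \<in> \<int>}"

definition pure_subgroup :: "(real^'n::finite) set \<Rightarrow> bool" where
  "pure_subgroup G \<longleftrightarrow> (\<exists>U. subspace U \<and> G = U \<inter> zlat)"

definition ipoly_in :: "(real^'n::finite) set \<Rightarrow> (real^'n::finite) set \<Rightarrow> bool" where
  "ipoly_in G P \<longleftrightarrow> (\<exists>S. finite S \<and> S \<noteq> {} \<and> S \<subseteq> G \<and> P = convex hull S)"

definition msum :: "(real^'n::finite) set \<Rightarrow> (real^'n::finite) set \<Rightarrow> (real^'n::finite) set" where
  "msum P Q = {p + q | p q. p \<in> P \<and> q \<in> Q}"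

type_synonym 'n pcls = "((real^'n::finite) set \<times> (real^'n::finite) set) set"

text \<open>Grothendieck group P(Z^n): classes of formal differences P - Q of integral polytopes.\<close>
definition gcls :: "(real^'n::finite) set \<Rightarrow> (real^'n::finite) set \<Rightarrow> 'n pcls" where
  "gcls P Q = {(P', Q'). ipoly_in zlat P' \<and> ipoly_in zlat Q' \<and> msum P Q' = msum P' Q}"

text \<open>P_T(Z^n) = P(Z^n) / {{h} : h in Z^n}: classes of P - Q modulo translation by lattice points.\<close>
definition tcls :: "(real^'n::finite) set \<Rightarrow> (real^'n::finite) set \<Rightarrow> 'n pcls" where
  "tcls P Q = {(P', Q'). ipoly_in zlat P' \<and> ipoly_in zlat Q' \<and>
      (\<exists>h\<in>zlat. msum P Q' = (\<lambda>x. x + h) ` msum P' Q)}"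

definition rep :: "'n::finite pcls \<Rightarrow> (real^'n::finite) set \<times> (real^'n::finite) set" where
  "rep a = (SOME p. p \<in> a)"

definition Pgrp :: "'n::finite pcls monoid" where
  "Pgrp = \<lparr>carrier = {gcls P Q | P Q. ipoly_in zlat P \<and> ipoly_in zlat Q},
           mult = (\<lambda>a b. gcls (msum (fst (rep a)) (fst (rep b))) (msum (snd (rep a)) (snd (rep b)))),
           one = gcls {0} {0}\<rparr>"

definition PTgrp :: "'n::finite pcls monoid" where
  "PTgrp = \<lparr>carrier = {tcls P Q | P Q. ipoly_in zlat P \<and> ipoly_in zlat Q},
           mult = (\<lambda>a b. tcls (msum (fst (rep a)) (fst (rep b))) (msum (snd (rep a)) (snd (rep b)))),
           one = tcls {0} {0}\<rparr>"

definition proj_T :: "'n::finite pcls \<Rightarrow> 'n pcls" where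
  "proj_T a = tcls (fst (rep a)) (snd (rep a))"

text \<open>The subgroup P_T(G) of P_T(Z^n) (image of the induced map).\<close>
definition PT_sub :: "(real^'n::finite) set \<Rightarrow> 'n pcls set" where
  "PT_sub G = {tcls P Q | P Q. ipoly_in G P \<and> ipoly_in G Q}"

definition PT_m :: "(real^'n::finite) set \<Rightarrow> nat \<Rightarrow> 'n pcls set" where
  "PT_m G m = generate PTgrp {tcls P {0} | P. ipoly_in G P \<and> aff_dim P \<le> int m}"

definition Zgrp :: "(real^'n::finite) monoid" where
  "Zgrp = \<lparr>carrier = zlat, mult = (+), one = 0\<rparr>"

definition zbasis :: "('a, 'b) monoid_scheme \<Rightarrow> 'a set \<Rightarrow> 'a set \<Rightarrow> bool" where
  "zbasis Grp S B \<longleftrightarrow> B \<subseteq> S \<and>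
     (\<forall>x\<in>S. \<exists>!c :: 'a \<Rightarrow> int. (\<forall>b. b \<notin> B \<longrightarrow> c b = 0) \<and> finite {b. c b \<noteq> 0} \<and>
        x = finprod Grp (\<lambda>b. b [^]\<^bsub>Grp\<^esub> c b) {b. c b \<noteq> 0})"

end

theory Submission
  imports Defs "HOL-Library.Function_Algebras"
begin

text \<open>
  Polytopes are replaced by their support functions, so that Minkowski sum becomes addition of
  functions and translation by a lattice point becomes addition of a lattice functional.

  The quotient of the classes of lattice polytopes of dimension at most \<^term>\<open>m\<close> by those of smaller
  dimension splits over the rational subspaces of dimension \<^term>\<open>m\<close>: taking the face in a generic
  normal direction of such a subspace \<^term>\<open>U\<close> isolates the summand of \<^term>\<open>U\<close>. The summand of
  \<^term>\<open>U\<close> is computed by induction. Split the lattice of \<^term>\<open>U\<close> as a hyperplane \<^term>\<open>U0\<close> plus a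
  vector \<^term>\<open>e\<close>. For a hyperplane \<^term>\<open>V\<close> of \<^term>\<open>U\<close> not containing \<^term>\<open>e\<close>, send a polytope \<^term>\<open>F\<close> in
  \<^term>\<open>V\<close> to its shadow, the region between \<^term>\<open>F\<close> and its projection to \<^term>\<open>U0\<close> along \<^term>\<open>e\<close>. On
  support functions this is precomposition with a map, hence additive. Modulo lower dimension the
  shadows over all \<^term>\<open>V\<close> different from \<^term>\<open>U0\<close> form a direct sum decomposition:
  they generate, because a Radon partition of the projected vertices gives an alternating relation
  that reduces the number of vertices, and they are independent, because the difference of the two
  faces orthogonal to \<^term>\<open>V\<close> recovers \<^term>\<open>F\<close>. So the shadows of the basis polytopes of all these
  \<^term>\<open>V\<close> form a basis.
\<close>

text \<open>The basis must not depend on the pure subgroup, and this shapes the argument: one local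
  basis is fixed for every rational subspace, and a basis class lies in
  \<open>PT_sub (V \<inter> zlat)\<close> exactly when its direction space lies in V. The quotients
  by lower dimension are never formed. Instead each basis polytope has a dual functional, additive
  on all lattice polytopes but prescribed to vanish only up to its own dimension, and a relation is
  tested at its top dimension. Everything stays integral because \<open>g\<close> has integer values
  on the lattice of U and the value 1 at \<open>e\<close>, so that projection along \<open>e\<close>
  preserves this lattice, and because the leading term of a Radon relation has coefficient 1 or -1.
  The hyperplanes V left out contribute nothing new: if \<open>e\<close> lies in V, the shadow stays
  parallel to V; over U0 it is a prism, whose support function is an integer combination of
  lower-dimensional ones. The induction starts in dimension 1, since translation invariance of the
  functionals rests on points having dimension below that of U.\<close>

definition int_scale :: "int \<Rightarrow> ('a \<Rightarrow> real) \<Rightarrow> 'a \<Rightarrow> real" where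
  "int_scale k f = (\<lambda>x. of_int k * f x)"

lemma int_scale_apply [simp]: "int_scale k f x = of_int k * f x"
  by (simp add: int_scale_def)

text \<open>Scalars are integers, so \<open>zm.subspace\<close> means subgroup and
  \<open>zm.span\<close> the subgroup generated.\<close>

interpretation zm: module int_scale
  by standard (auto simp: fun_eq_iff algebra_simps)

lemma sum_fun_apply: "(\<Sum>i\<in>I. f i) x = (\<Sum>i\<in>I. f i x)" for f :: "'i \<Rightarrow> 'a \<Rightarrow> 'b::comm_monoid_add"
  by (induction I rule: infinite_finite_induct) auto

subsection \<open>Lattice polytopes and support functions\<close>

lemma zlat_0 [simp]: "0 \<in> zlat"
  and zlat_add: "x \<in> zlat \<Longrightarrow> y \<in> zlat \<Longrightarrow> x + y \<in> zlat"
  and zlat_diff: "x \<in> zlat \<Longrightarrow> y \<in> zlat \<Longrightarrow> x - y \<in> zlat"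
  and zlat_minus: "x \<in> zlat \<Longrightarrow> - x \<in> zlat"
  by (auto simp: zlat_def)

lemma zlat_scale: "k \<in> \<int> \<Longrightarrow> x \<in> zlat \<Longrightarrow> k *\<^sub>R x \<in> zlat"
  by (auto simp: zlat_def)

lemma countable_zlat: "countable (zlat :: (real^'n::finite) set)"
proof -
  have "zlat \<subseteq> range (\<lambda>f :: 'n \<Rightarrow> int. (\<chi> i. of_int (f i)) :: real^'n)"
  proof
    fix x :: "real^'n" assume "x \<in> zlat"
    then have "\<forall>i. \<exists>k. x $ i = of_int k" by (auto simp: zlat_def elim: Ints_cases)
    then obtain f where "\<forall>i. x $ i = of_int (f i)" by metis
    then have "x = (\<chi> i. of_int (f i))" by (simp add: vec_eq_iff)
    then show "x \<in> range (\<lambda>f :: 'n \<Rightarrow> int. (\<chi> i. of_int (f i)))" by blast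
  qed
  then show ?thesis by (rule countable_subset) simp
qed

definition lin :: "real^'n::finite \<Rightarrow> real^'n \<Rightarrow> real" where
  "lin v = (\<lambda>u. u \<bullet> v)"

text \<open>The support functions of lattice points: dividing by this subgroup turns P into
  P_T.\<close>

definition lattice_lin :: "(real^'n::finite \<Rightarrow> real) set" where
  "lattice_lin = lin ` zlat"

definition supp :: "(real^'n::finite) set \<Rightarrow> real^'n \<Rightarrow> real" where
  "supp P u = (SUP x\<in>P. u \<bullet> x)"

lemma lin_add: "lin (v + w) = lin v + lin w"
  and lin_0: "lin 0 = 0"
  and lin_scale: "lin (of_int k *\<^sub>R v) = int_scale k (lin v)"
  by (auto simp: lin_def fun_eq_iff algebra_simps)

lemma lin_inject: "lin v = lin w \<longleftrightarrow> v = w"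
proof
  assume "lin v = lin w"
  then have "lin v (v - w) = lin w (v - w)" by simp
  then have "(v - w) \<bullet> (v - w) = 0" by (simp add: lin_def algebra_simps)
  then show "v = w" by simp
qed simp

lemma subspace_lattice_lin: "zm.subspace (lattice_lin :: (real^'n::finite \<Rightarrow> real) set)"
  unfolding zm.subspace_def lattice_lin_def
proof (intro conjI ballI allI)
  show "0 \<in> lin ` zlat" by (rule image_eqI[of _ _ 0]) (auto simp: lin_0)
next
  fix x y :: "real^'n \<Rightarrow> real" assume "x \<in> lin ` zlat" "y \<in> lin ` zlat"
  then show "x + y \<in> lin ` zlat" by (auto simp: lin_add[symmetric] zlat_add)
next
  fix c and x :: "real^'n \<Rightarrow> real" assume "x \<in> lin ` zlat"
  then show "int_scale c x \<in> lin ` zlat" by (auto simp: lin_scale[symmetric] zlat_scale)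
qed

lemma supp_eqI: "x \<in> P \<Longrightarrow> (\<And>y. y \<in> P \<Longrightarrow> u \<bullet> y \<le> u \<bullet> x) \<Longrightarrow> supp P u = u \<bullet> x"
  unfolding supp_def by (rule cSup_eq_maximum) auto

lemma ipoly_inE:
  assumes "ipoly_in G P"
  obtains S where "finite S" "S \<noteq> {}" "S \<subseteq> G" "P = convex hull S"
  using assms by (auto simp: ipoly_in_def)

lemma ipoly_in_hull: "finite S \<Longrightarrow> S \<noteq> {} \<Longrightarrow> S \<subseteq> G \<Longrightarrow> ipoly_in G (convex hull S)"
  by (auto simp: ipoly_in_def)

lemma ipoly_in_mono: "ipoly_in G P \<Longrightarrow> G \<subseteq> H \<Longrightarrow> ipoly_in H P"
  unfolding ipoly_in_def by blast

lemma ipoly_in_sing: "v \<in> G \<Longrightarrow> ipoly_in G {v}"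
  using ipoly_in_hull[of "{v}" G] by simp

lemma ipoly_in_convex: "ipoly_in G P \<Longrightarrow> convex P"
  and ipoly_in_compact: "ipoly_in G P \<Longrightarrow> compact P"
  and ipoly_in_nonempty: "ipoly_in G P \<Longrightarrow> P \<noteq> {}"
  by (auto simp: ipoly_in_def finite_imp_compact_convex_hull)

lemma ipoly_attains:
  assumes "ipoly_in G P"
  obtains x where "x \<in> P" "\<And>y. y \<in> P \<Longrightarrow> u \<bullet> y \<le> u \<bullet> x" "supp P u = u \<bullet> x"
proof -
  have "\<exists>x\<in>P. \<forall>y\<in>P. u \<bullet> y \<le> u \<bullet> x"
    by (rule continuous_attains_sup)
      (use ipoly_in_compact[OF assms] ipoly_in_nonempty[OF assms] in \<open>auto intro: continuous_intros\<close>)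
  then show thesis using that supp_eqI by metis
qed

lemma le_supp: "ipoly_in G P \<Longrightarrow> y \<in> P \<Longrightarrow> u \<bullet> y \<le> supp P u"
  by (metis ipoly_attains)

lemma supp_hull:
  assumes "finite S" "S \<noteq> {}"
  shows "supp (convex hull S) u = Max ((\<bullet>) u ` S)"
proof -
  have "Max ((\<bullet>) u ` S) \<in> (\<bullet>) u ` S" using assms by simp
  then obtain x where x: "x \<in> S" "Max ((\<bullet>) u ` S) = u \<bullet> x" by blast
  have "convex hull S \<subseteq> {y. u \<bullet> y \<le> u \<bullet> x}"
    by (rule hull_minimal) (use assms x in \<open>auto simp: convex_halfspace_le simp flip: x(2)\<close>)
  then show ?thesis using x by (auto intro!: supp_eqI simp: hull_inc)
qed

lemma supp_sing: "supp {v} = lin v"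
  by (auto simp: lin_def fun_eq_iff intro!: supp_eqI)

text \<open>A point of P outside Q is separated from Q by a hyperplane, whose normal distinguishes
  the support functions. Cancellation for Minkowski sums is contained in this, since functions form
  a group.\<close>

lemma supp_inject:
  assumes "ipoly_in G P" "ipoly_in H Q" "supp P = supp Q"
  shows "P = Q"
proof -
  have *: "P \<subseteq> Q" if "ipoly_in G P" "ipoly_in H Q" "supp P = supp Q" for G H and P Q :: "(real^'n) set"
  proof (rule ccontr)
    assume "\<not> P \<subseteq> Q"
    then obtain z where z: "z \<in> P" "z \<notin> Q" by auto
    have "convex Q" "closed Q" using that(2) by (auto intro: ipoly_in_convex ipoly_in_compact compact_imp_closed)
    from separating_hyperplane_closed_point[OF this z(2)]
    obtain a b where ab: "a \<bullet> z < b" "\<forall>x\<in>Q. b < a \<bullet> x" by blast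
    \<comment> \<open>The hyperplane has Q on its upper side, so the violated support inequality is
      the one in direction \<open>- a\<close>.\<close>
    from ipoly_attains[OF that(2), of "- a"]
    obtain x where x: "x \<in> Q" "supp Q (- a) = (- a) \<bullet> x" by blast
    have "(- a) \<bullet> z \<le> supp P (- a)" using that(1) z(1) by (rule le_supp)
    then have "a \<bullet> x \<le> a \<bullet> z" using that(3) x(2) by simp
    with x(1) ab show False by force
  qed
  show ?thesis using *[OF assms] *[OF assms(2,1)] assms(3) by auto
qed

lemma msum_ipoly_in:
  assumes "ipoly_in G P" "ipoly_in G Q" "\<And>x y. x \<in> G \<Longrightarrow> y \<in> G \<Longrightarrow> x + y \<in> G"
  shows "ipoly_in G (msum P Q)"
proof -
  obtain S where S: "finite S" "S \<noteq> {}" "S \<subseteq> G" "P = convex hull S" using assms(1) by (rule ipoly_inE)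
  obtain T where T: "finite T" "T \<noteq> {}" "T \<subseteq> G" "Q = convex hull T" using assms(2) by (rule ipoly_inE)
  have "msum P Q = P + Q" by (auto simp: msum_def set_plus_def)
  then have "msum P Q = convex hull (S + T)" by (simp add: convex_hull_set_plus S T)
  moreover have "finite (S + T)" using S T by (simp add: finite_set_plus)
  moreover have "S + T \<noteq> {}" using S T by (fastforce simp: set_plus_def)
  moreover have "S + T \<subseteq> G" using S(3) T(3) assms(3) by (auto simp: set_plus_def)
  ultimately show ?thesis using ipoly_in_hull by metis
qed

lemma msum_ipoly_zlat: "ipoly_in zlat P \<Longrightarrow> ipoly_in zlat Q \<Longrightarrow> ipoly_in zlat (msum P Q)"
  by (rule msum_ipoly_in) (auto simp: zlat_add)

lemma supp_msum:
  assumes "ipoly_in G P" "ipoly_in G Q"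
  shows "supp (msum P Q) = supp P + supp Q"
proof
  fix u
  from ipoly_attains[OF assms(1), of u]
  obtain x where x: "x \<in> P" "\<And>y. y \<in> P \<Longrightarrow> u \<bullet> y \<le> u \<bullet> x" "supp P u = u \<bullet> x" by blast
  from ipoly_attains[OF assms(2), of u]
  obtain z where z: "z \<in> Q" "\<And>y. y \<in> Q \<Longrightarrow> u \<bullet> y \<le> u \<bullet> z" "supp Q u = u \<bullet> z" by blast
  have "supp (msum P Q) u = u \<bullet> (x + z)"
    by (rule supp_eqI) (auto simp: msum_def inner_add_right intro!: add_mono x z)
  then show "supp (msum P Q) u = (supp P + supp Q) u" by (simp add: x z inner_add_right)
qed

lemma msum_sing: "msum P {v} = (\<lambda>x. x + v) ` P"
  by (auto simp: msum_def)

lemma translate_ipoly_in: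
  assumes "ipoly_in G P" "\<And>x. x \<in> G \<Longrightarrow> x + v \<in> H"
  shows "ipoly_in H ((\<lambda>x. x + v) ` P)"
proof -
  obtain S where S: "finite S" "S \<noteq> {}" "S \<subseteq> G" "P = convex hull S" using assms(1) by (rule ipoly_inE)
  have "(\<lambda>x. x + v) ` P = convex hull ((\<lambda>x. x + v) ` S)"
    using convex_hull_translation[of v S] by (simp add: S add.commute)
  moreover have "(\<lambda>x. x + v) ` S \<subseteq> H" using S(3) assms(2) by blast
  ultimately show ?thesis using S(1,2) ipoly_in_hull[of "(\<lambda>x. x + v) ` S"] by simp
qed

lemma supp_translate:
  assumes "ipoly_in G P"
  shows "supp ((\<lambda>x. x + v) ` P) = supp P + lin v"
  using supp_msum[OF ipoly_in_mono[OF assms subset_UNIV] ipoly_in_sing[OF UNIV_I]]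
  by (simp add: msum_sing supp_sing)

lemma aff_dim_translate: "aff_dim ((\<lambda>x. x + v) ` P) = aff_dim P" for v :: "'a::euclidean_space"
  using aff_dim_translation_eq[of v P] by (simp add: add.commute)

subsection \<open>Direction spaces\<close>

text \<open>P lies in a translate of U. Differences avoid the choice of a base point.\<close>

definition par :: "'a::euclidean_space set \<Rightarrow> 'a set \<Rightarrow> bool" where
  "par P U \<longleftrightarrow> (\<forall>x\<in>P. \<forall>y\<in>P. x - y \<in> U)"

lemma par_subset: "par P U \<Longrightarrow> Q \<subseteq> P \<Longrightarrow> par Q U"
  by (auto simp: par_def)

lemma par_mono: "par P U \<Longrightarrow> U \<subseteq> V \<Longrightarrow> par P V"
  by (auto simp: par_def)

lemma par_translate: "par ((\<lambda>x. x + v) ` P) U \<longleftrightarrow> par P U"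
  by (auto simp: par_def)

lemma affine_coset: "subspace U \<Longrightarrow> affine {x. x - a \<in> U}"
  unfolding affine_def
proof clarify
  fix x y and u v :: real
  assume *: "subspace U" "x - a \<in> U" "y - a \<in> U" "u + v = 1"
  then have "a = u *\<^sub>R a + v *\<^sub>R a" by (simp flip: scaleR_add_left)
  then have "u *\<^sub>R x + v *\<^sub>R y - a = u *\<^sub>R (x - a) + v *\<^sub>R (y - a)"
    by (simp add: algebra_simps)
  then show "u *\<^sub>R x + v *\<^sub>R y - a \<in> U" using * by (simp add: subspace_add subspace_scale)
qed

lemma par_affine_hull:
  assumes "subspace U" "par P U"
  shows "par (affine hull P) U"
proof (cases "P = {}")
  case False
  then obtain a where a: "a \<in> P" by blast
  have "affine hull P \<subseteq> {x. x - a \<in> U}"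
    by (rule hull_minimal) (use assms a in \<open>auto simp: par_def affine_coset\<close>)
  then have "(x - a) - (y - a) \<in> U" if "x \<in> affine hull P" "y \<in> affine hull P" for x y
    using that subspace_diff[OF assms(1)] by blast
  then show ?thesis by (simp add: par_def)
qed (auto simp: par_def)

lemma par_hull: "subspace U \<Longrightarrow> par S U \<Longrightarrow> par (convex hull S) U"
  using par_affine_hull par_subset convex_hull_subset_affine_hull by blast

lemma par_ipoly_in:
  assumes "subspace U" "G \<subseteq> U" "ipoly_in G P"
  shows "par P U"
proof -
  obtain S where "S \<subseteq> G" "P = convex hull S" using assms(3) by (rule ipoly_inE)
  moreover have "par S U" using assms \<open>S \<subseteq> G\<close> by (auto simp: par_def subset_iff intro: subspace_diff)
  ultimately show ?thesis using par_hull[OF assms(1)] by simp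
qed

lemma aff_dim_par_le:
  assumes "subspace U" "par P U"
  shows "aff_dim P \<le> int (dim U)"
proof (cases "P = {}")
  case False
  then obtain a where a: "a \<in> P" by blast
  have "aff_dim P = int (dim ((\<lambda>x. x - a) ` P))"
    by (rule aff_dim_eq_dim_subtract) (use a in \<open>simp add: hull_inc\<close>)
  moreover have "dim ((\<lambda>x. x - a) ` P) \<le> dim U"
    by (rule dim_subset) (use assms a in \<open>auto simp: par_def\<close>)
  ultimately show ?thesis by simp
qed simp

text \<open>Equal affine dimension forces equal affine hulls, so a full-dimensional face determines
  the directions of the whole polytope.\<close>

lemma par_extend:
  assumes "F \<subseteq> P" "F \<noteq> {}" "aff_dim F = aff_dim P" "subspace U" "par F U"
  shows "par P U"
proof -
  have "affine hull F = affine hull P"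
    by (rule affine_dim_equal) (use assms in \<open>auto simp: hull_mono\<close>)
  then show ?thesis using par_affine_hull[OF assms(4,5)] by (metis hull_subset par_subset)
qed

text \<open>P lies in a translate of the intersection, a proper subspace of V. This is what
  separates different direction spaces.\<close>

lemma aff_dim_par_two:
  assumes "subspace U" "subspace V" "par P U" "par P V" "dim U \<le> dim V" "U \<noteq> V"
  shows "aff_dim P < int (dim V)"
proof -
  have "dim (U \<inter> V) < dim V"
  proof (rule ccontr)
    assume "\<not> dim (U \<inter> V) < dim V"
    then have "U \<inter> V = V" using assms by (intro subspace_dim_equal) (auto simp: subspace_inter)
    then have "V \<subseteq> U" by blast
    then have "V = U" using assms by (intro subspace_dim_equal) auto
    then show False using assms by simp
  qed
  moreover have "aff_dim P \<le> int (dim (U \<inter> V))"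
    by (rule aff_dim_par_le) (use assms in \<open>auto simp: par_def subspace_inter\<close>)
  ultimately show ?thesis by simp
qed

definition dirspace :: "'a::euclidean_space set \<Rightarrow> 'a set" where
  "dirspace P = span {x - y | x y. x \<in> P \<and> y \<in> P}"

lemma subspace_dirspace: "subspace (dirspace P)"
  and par_dirspace: "par P (dirspace P)"
  by (auto simp: dirspace_def par_def intro: span_base)

lemma dirspace_minimal: "subspace U \<Longrightarrow> par P U \<Longrightarrow> dirspace P \<subseteq> U"
  unfolding dirspace_def by (rule span_minimal) (auto simp: par_def)

lemma dim_dirspace:
  assumes "P \<noteq> {}"
  shows "int (dim (dirspace P)) = aff_dim P"
proof -
  obtain a where a: "a \<in> P" using assms by blast
  have 1: "aff_dim P = int (dim ((\<lambda>x. x - a) ` P))"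
    by (rule aff_dim_eq_dim_subtract) (use a in \<open>simp add: hull_inc\<close>)
  have "dirspace P \<subseteq> span ((\<lambda>x. x - a) ` P)"
  proof (rule dirspace_minimal)
    show "par P (span ((\<lambda>x. x - a) ` P))"
      unfolding par_def
    proof clarify
      fix x y assume "x \<in> P" "y \<in> P"
      then have "(x - a) - (y - a) \<in> span ((\<lambda>x. x - a) ` P)" by (intro span_diff span_base) auto
      then show "x - y \<in> span ((\<lambda>x. x - a) ` P)" by simp
    qed
  qed simp
  then have "dim (dirspace P) \<le> dim ((\<lambda>x. x - a) ` P)" by (metis dim_span dim_subset)
  with 1 aff_dim_par_le[OF subspace_dirspace par_dirspace, of P] show ?thesis by linarith
qed

lemma dirspace_eq: 
  assumes "subspace U" "par P U" "P \<noteq> {}" "aff_dim P = int (dim U)"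
  shows "dirspace P = U"
  using assms dim_dirspace[OF assms(3)] dirspace_minimal[OF assms(1,2)] 
  by (intro subspace_dim_equal) (auto simp: subspace_dirspace)

text \<open>Direction spaces of lattice polytopes are of this kind, whereas the subspace that
  defines a pure subgroup may be arbitrary.\<close>

definition ratsub :: "(real^'n::finite) set \<Rightarrow> bool" where
  "ratsub U \<longleftrightarrow> subspace U \<and> U = span (U \<inter> zlat)"

lemma ratsub_subspace: "ratsub U \<Longrightarrow> subspace U"
  by (simp add: ratsub_def)

lemma ratsub_span: "S \<subseteq> zlat \<Longrightarrow> ratsub (span S)"
proof -
  assume "S \<subseteq> zlat"
  then have "span S \<subseteq> span (span S \<inter> zlat)" by (intro span_mono) (auto intro: span_base)
  moreover have "span (span S \<inter> zlat) \<subseteq> span S" by (intro span_minimal) auto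
  ultimately show ?thesis by (auto simp: ratsub_def)
qed

lemma ratsub_dirspace: "S \<subseteq> zlat \<Longrightarrow> ratsub (dirspace S)"
  unfolding dirspace_def by (rule ratsub_span) (auto intro: zlat_diff)

subsection \<open>Faces\<close>

definition face :: "real^'n::finite \<Rightarrow> (real^'n) set \<Rightarrow> (real^'n) set" where
  "face w P = {x \<in> P. \<forall>y\<in>P. w \<bullet> y \<le> w \<bullet> x}"

lemma face_subset: "face w P \<subseteq> P"
  by (auto simp: face_def)

lemma face_eq_self:
  assumes "\<And>x y. x \<in> P \<Longrightarrow> y \<in> P \<Longrightarrow> w \<bullet> (x - y) = 0"
  shows "face w P = P"
proof -
  have "w \<bullet> y \<le> w \<bullet> x" if "x \<in> P" "y \<in> P" for x y
    using assms[OF that] by (simp add: inner_diff_right)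
  then show ?thesis by (auto simp: face_def)
qed

text \<open>A sum p + q maximises w exactly when both summands do. Hence an additive functional
  stays additive when it is evaluated on faces.\<close>

lemma face_msum: "face w (msum P Q) = msum (face w P) (face w Q)"
proof (intro equalityI subsetI)
  fix z assume "z \<in> face w (msum P Q)"
  then obtain p q where pq: "z = p + q" "p \<in> P" "q \<in> Q"
    and m: "\<And>x y. x \<in> P \<Longrightarrow> y \<in> Q \<Longrightarrow> w \<bullet> (x + y) \<le> w \<bullet> (p + q)"
    unfolding face_def msum_def by blast
  have "p \<in> face w P" using pq m[of _ q] by (auto simp: face_def inner_add_right)
  moreover have "q \<in> face w Q" using pq m[of p] by (auto simp: face_def inner_add_right)
  ultimately show "z \<in> msum (face w P) (face w Q)" using pq by (auto simp: msum_def)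
qed (auto simp: face_def msum_def inner_add_right intro!: add_mono)

lemma face_ipoly_in:
  assumes "ipoly_in G P"
  shows "ipoly_in G (face w P)"
proof -
  obtain S where S: "finite S" "S \<noteq> {}" "S \<subseteq> G" "P = convex hull S" using assms by (rule ipoly_inE)
  from ipoly_attains[OF assms, of w]
  obtain x where x: "x \<in> P" "\<And>y. y \<in> P \<Longrightarrow> w \<bullet> y \<le> w \<bullet> x" by blast
  have "face w P = P \<inter> {y. w \<bullet> y = w \<bullet> x}" using x by (force simp: face_def)
  moreover have "(P \<inter> {y. w \<bullet> y = w \<bullet> x}) face_of P"
    by (rule face_of_Int_supporting_hyperplane_le) (use x assms in \<open>auto intro: ipoly_in_convex\<close>)
  ultimately obtain S' where "S' \<subseteq> S" "face w P = convex hull S'"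
    using face_of_convex_hull_subset[of S] S by (metis finite_imp_compact)
  moreover have "face w P \<noteq> {}" using x by (auto simp: face_def)
  ultimately show ?thesis using S finite_subset unfolding ipoly_in_def
    by (metis convex_hull_empty order_trans)
qed

text \<open>The face is a hull of lattice points; their differences are lattice vectors orthogonal
  to w and fall into U by the choice of w.\<close>

lemma par_face:
  assumes "ipoly_in zlat P" "subspace U" "\<And>z. z \<in> zlat \<Longrightarrow> w \<bullet> z = 0 \<Longrightarrow> z \<in> U"
  shows "par (face w P) U"
proof -
  obtain S where S: "finite S" "S \<noteq> {}" "S \<subseteq> zlat" "face w P = convex hull S"
    using face_ipoly_in[OF assms(1)] by (rule ipoly_inE)
  have "x - y \<in> U" if "x \<in> S" "y \<in> S" for x y
  proof -
    have "x \<in> face w P" "y \<in> face w P" using that S(4) by (auto simp: hull_inc)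
    then have "w \<bullet> (x - y) = 0" by (force simp: face_def inner_diff_right)
    then show ?thesis using assms(3) S(3) that zlat_diff by blast
  qed
  then show ?thesis using S(4) par_hull[OF assms(2), of S] by (simp add: par_def)
qed

text \<open>Each lattice vector outside U rules out the vectors orthogonal to its component normal
  to U, a hyperplane. Countably many hyperplanes have measure zero, so some vector survives, and its
  part orthogonal to U is w.\<close>

lemma generic_normal:
  fixes U :: "(real^'n::finite) set"
  assumes "subspace U"
  obtains w where "\<And>x. x \<in> U \<Longrightarrow> w \<bullet> x = 0" "\<And>z. z \<in> zlat \<Longrightarrow> w \<bullet> z = 0 \<Longrightarrow> z \<in> U"
proof -
  have "\<exists>p. p \<noteq> 0 \<and> (\<forall>x\<in>U. p \<bullet> x = 0) \<and> z - p \<in> U" if z: "z \<notin> U" for z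
  proof -
    obtain y p where yp: "y \<in> span U" "\<And>x. x \<in> span U \<Longrightarrow> orthogonal p x" "z = y + p"
      using orthogonal_subspace_decomp_exists[of U z] by metis
    then show ?thesis using assms z by (intro exI[of _ p]) (auto simp: orthogonal_def span_eq_iff[THEN iffD2])
  qed
  then obtain p where p: "\<And>z. z \<notin> U \<Longrightarrow> p z \<noteq> 0" "\<And>z x. z \<notin> U \<Longrightarrow> x \<in> U \<Longrightarrow> p z \<bullet> x = 0"
    "\<And>z. z \<notin> U \<Longrightarrow> z - p z \<in> U" by metis
  have "negligible (\<Union>z\<in>zlat - U. {x. p z \<bullet> x = 0})"
  proof (rule negligible_countable_Union)
    show "countable ((\<lambda>z. {x. p z \<bullet> x = 0}) ` (zlat - U))"
      by (metis countable_Diff countable_image countable_zlat)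
    show "negligible s" if "s \<in> (\<lambda>z. {x. p z \<bullet> x = 0}) ` (zlat - U)" for s
      using that p(1) by (auto intro: negligible_hyperplane)
  qed
  then have "(\<Union>z\<in>zlat - U. {x. p z \<bullet> x = 0}) \<noteq> UNIV" using non_negligible_UNIV by metis
  then obtain x where x: "\<And>z. z \<in> zlat - U \<Longrightarrow> p z \<bullet> x \<noteq> 0" by blast
  obtain y w where yw: "y \<in> span U" "\<And>v. v \<in> span U \<Longrightarrow> orthogonal w v" "x = y + w"
    using orthogonal_subspace_decomp_exists[of U x] by metis
  have U: "span U = U" using assms by (simp add: span_eq_iff)
  show thesis
  proof
    show "w \<bullet> v = 0" if "v \<in> U" for v using yw(2)[of v] that U by (simp add: orthogonal_def)
    show "z \<in> U" if "z \<in> zlat" "w \<bullet> z = 0" for z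
    proof (rule ccontr)
      assume z: "z \<notin> U"
      have "w \<bullet> (z - p z) = 0" using yw(2) p(3)[OF z] U by (simp add: orthogonal_def)
      then have "w \<bullet> p z = 0" using that by (simp add: inner_diff_right)
      \<comment> \<open>\<open>p z\<close> is orthogonal to U, so it has the same product with
        \<open>x\<close> as with the normal part \<open>w\<close> of \<open>x\<close>.\<close>
      moreover have "p z \<bullet> y = 0" using p(2)[OF z] yw(1) U by simp
      ultimately have "p z \<bullet> x = 0" by (simp add: yw(3) inner_add_right inner_commute)
      then show False using x z that by blast
    qed
  qed
qed

subsection \<open>Shadows and the tilting operator\<close>

text \<open>A piecewise linear map on directions: the half-space where \<open>x \<bullet> e\<close>
  is nonnegative is fixed, the other one is moved along g, for \<open>g \<bullet> e = 1\<close> onto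
  the wall between them.\<close>

definition tilt :: "real^'n::finite \<Rightarrow> real^'n \<Rightarrow> real^'n \<Rightarrow> real^'n" where
  "tilt e g x = (if x \<bullet> e \<ge> 0 then x else x - (x \<bullet> e) *\<^sub>R g)"

definition rho :: "real^'n::finite \<Rightarrow> real^'n \<Rightarrow> (real^'n \<Rightarrow> real) \<Rightarrow> real^'n \<Rightarrow> real" where
  "rho e g f = (\<lambda>x. f (tilt e g x))"

text \<open>The projection along e onto the hyperplane g = 0 when \<open>g \<bullet> e = 1\<close>.
  It is adjoint to the moving branch of \<open>tilt\<close>.\<close>

definition prj :: "real^'n::finite \<Rightarrow> real^'n \<Rightarrow> real^'n \<Rightarrow> real^'n" where
  "prj e g x = x - (g \<bullet> x) *\<^sub>R e"

lemma rho_add: "rho e g (f + f') = rho e g f + rho e g f'"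
  and rho_0: "rho e g 0 = 0"
  and rho_scale: "rho e g (int_scale k f) = int_scale k (rho e g f)"
  by (auto simp: rho_def fun_eq_iff)

lemma rho_span:
  assumes "f \<in> zm.span X" "zm.subspace W" "\<And>x. x \<in> X \<Longrightarrow> rho e g x \<in> W"
  shows "rho e g f \<in> W"
  using assms(1)
proof (induction rule: zm.span_induct_alt)
  case base
  show ?case using zm.subspace_0[OF assms(2)] rho_0[of e g] by (simp add: zero_fun_def)
next
  case (step c x y)
  then show ?case
    unfolding rho_add rho_scale using assms(2,3) by (metis zm.subspace_add zm.subspace_scale)
qed

lemma linear_prj: "linear (prj e g)"
  by (rule linearI) (auto simp: prj_def algebra_simps inner_add_right)

lemma prj_minus: "prj (- e) (- g) = prj e g"
  by (auto simp: prj_def fun_eq_iff)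

lemma tilt_nonneg: "g \<bullet> e = 1 \<Longrightarrow> tilt e g x \<bullet> e \<ge> 0"
  by (auto simp: tilt_def inner_diff_left)

lemma inner_tilt_neg: "x \<bullet> e < 0 \<Longrightarrow> tilt e g x \<bullet> y = x \<bullet> prj e g y"
  by (auto simp: tilt_def prj_def algebra_simps)

text \<open>If f identifies two points of A, the two singletons already serve. Otherwise the images
  are too many for the dimension of U, and a Radon partition of them is pulled back.\<close>

lemma radon_linear_image:
  fixes f :: "'a::euclidean_space \<Rightarrow> 'b::euclidean_space"
  assumes "linear f" "finite A" "f ` A \<subseteq> U" "subspace U" "dim U + 1 < card A"
  obtains M N p q where "M \<subseteq> A" "N \<subseteq> A" "M \<inter> N = {}" "p \<in> convex hull M" "q \<in> convex hull N" "f p = f q"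
proof (cases "inj_on f A")
  case True
  have "affine_dependent (f ` A)"
  proof (rule ccontr)
    assume "\<not> affine_dependent (f ` A)"
    then have "int (card (f ` A)) = aff_dim (f ` A) + 1" by (rule aff_dim_affine_independent)
    also have "aff_dim (f ` A) \<le> aff_dim U" using assms(3) by (rule aff_dim_subset)
    also have "aff_dim U = int (dim U)" using assms(4) by (rule aff_dim_subspace)
    finally show False using assms(5) True by (simp add: card_image)
  qed
  then obtain M' N' where MN: "M' \<subseteq> f ` A" "N' \<subseteq> f ` A" "M' \<inter> N' = {}"
    "convex hull M' \<inter> convex hull N' \<noteq> {}" using Radon by metis
  define M where "M = {a \<in> A. f a \<in> M'}"
  define N where "N = {a \<in> A. f a \<in> N'}"
  have "f ` M = M'" "f ` N = N'" using MN by (auto simp: M_def N_def)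
  then have "convex hull M' = f ` (convex hull M)" "convex hull N' = f ` (convex hull N)"
    using convex_hull_linear_image[OF assms(1)] by metis+
  then obtain p q where "p \<in> convex hull M" "q \<in> convex hull N" "f p = f q" using MN(4) by fastforce
  then show thesis using that[of M N p q] MN by (auto simp: M_def N_def)
next
  case False
  then obtain a b where "a \<in> A" "b \<in> A" "a \<noteq> b" "f a = f b" by (auto simp: inj_on_def)
  then show thesis using that[of "{a}" "{b}" a b] by auto
qed

lemma supp_insert_dominated:
  assumes "finite S" "i \<in> S" "u \<bullet> j \<le> u \<bullet> i"
  shows "supp (convex hull (insert j S)) u = supp (convex hull S) u"
proof -
  have "S \<noteq> {}" using assms by auto
  moreover have "u \<bullet> j \<le> Max ((\<bullet>) u ` S)" using assms by (auto intro: order_trans[OF assms(3)])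
  then have "Max ((\<bullet>) u ` insert j S) = Max ((\<bullet>) u ` S)"
    using assms \<open>S \<noteq> {}\<close> by (auto simp: max_def)
  ultimately show ?thesis using assms by (simp add: supp_hull)
qed

text \<open>Evaluated at any direction, some point of \<^term>\<open>J\<close> is dominated by a point of \<^term>\<open>I\<close>;
  adding it to or removing it from \<^term>\<open>T\<close> cancels the terms in pairs.\<close>

lemma rho_radon_relation:
  fixes e g :: "real^'n::finite"
  assumes ge: "g \<bullet> e = 1" and fin: "finite I" "finite J" and disj: "I \<inter> J = {}"
    and pq: "p \<in> convex hull I" "q \<in> convex hull J" "prj e g p = prj e g q" "g \<bullet> q \<le> g \<bullet> p"
  shows "(\<Sum>T\<in>Pow J. int_scale ((-1) ^ card T) (rho e g (supp (convex hull (I \<union> T))))) = 0"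
proof
  fix x
  define y where "y = tilt e g x"
  have ne: "I \<noteq> {}" "J \<noteq> {}" using pq by auto
  have y: "y \<bullet> e \<ge> 0" unfolding y_def using ge by (rule tilt_nonneg)
  have "y \<bullet> q = y \<bullet> prj e g q + (g \<bullet> q) * (y \<bullet> e)" "y \<bullet> p = y \<bullet> prj e g p + (g \<bullet> p) * (y \<bullet> e)"
    by (auto simp: prj_def algebra_simps)
  \<comment> \<open>p lies above q on a common fibre along e, and a tilted direction does not
    decrease along e.\<close>
  then have "y \<bullet> q \<le> y \<bullet> p" using pq y by (simp add: mult_right_mono)
  also have "y \<bullet> p \<le> supp (convex hull I) y"
    using pq(1) by (intro le_supp[of UNIV] ipoly_in_hull) (use fin ne in auto)
  also have "\<dots> = Max ((\<bullet>) y ` I)" using fin ne by (simp add: supp_hull)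
  finally have qI: "y \<bullet> q \<le> Max ((\<bullet>) y ` I)" .
  have "Max ((\<bullet>) y ` I) \<in> (\<bullet>) y ` I" using fin ne by simp
  then obtain i where i: "i \<in> I" "y \<bullet> q \<le> y \<bullet> i" using qI by auto
  have "- y \<bullet> q \<le> supp (convex hull J) (- y)"
    using pq(2) by (intro le_supp[of UNIV] ipoly_in_hull) (use fin ne in auto)
  also have "\<dots> = Max ((\<bullet>) (- y) ` J)" using fin ne by (simp add: supp_hull)
  finally have qJ: "- y \<bullet> q \<le> Max ((\<bullet>) (- y) ` J)" .
  have "Max ((\<bullet>) (- y) ` J) \<in> (\<bullet>) (- y) ` J" using fin ne by simp
  then obtain j where j: "j \<in> J" "y \<bullet> j \<le> y \<bullet> q" using qJ by auto
  define K where "K = J - {j}"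
  have K: "J = insert j K" "j \<notin> K" "finite K" using j fin by (auto simp: K_def)
  define t where "t T = (-1) ^ card T * supp (convex hull (I \<union> T)) y" for T
  have "(\<Sum>T\<in>Pow J. t T) = (\<Sum>T\<in>Pow K. t T) + (\<Sum>T\<in>insert j ` Pow K. t T)"
    unfolding K(1) Pow_insert using K by (intro sum.union_disjoint) auto
  also have "(\<Sum>T\<in>insert j ` Pow K. t T) = (\<Sum>T\<in>Pow K. t (insert j T))"
    using K(2) by (subst sum.reindex) (auto simp: inj_on_def)
  also have "\<dots> = (\<Sum>T\<in>Pow K. - t T)"
  proof (rule sum.cong)
    fix T assume T: "T \<in> Pow K"
    then have "finite T" "j \<notin> T" using K finite_subset by auto
    moreover have "supp (convex hull (I \<union> insert j T)) y = supp (convex hull (I \<union> T)) y"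
      using supp_insert_dominated[of "I \<union> T" i y j] fin i j \<open>finite T\<close> by simp
    ultimately show "t (insert j T) = - t T" by (simp add: t_def)
  qed simp
  finally have "(\<Sum>T\<in>Pow J. t T) = 0" by (simp add: sum_negf)
  then show "(\<Sum>T\<in>Pow J. int_scale ((-1) ^ card T) (rho e g (supp (convex hull (I \<union> T))))) x = 0 x"
    by (simp add: sum_fun_apply rho_def y_def t_def)
qed

text \<open>In the Radon relation the full set A occurs once, with sign 1 or -1, and all other terms
  belong to proper subsets. So the relation can be solved for A over the integers, down to subsets
  of at most m points.\<close>

lemma rho_radon_reduce:
  fixes e g :: "real^'n::finite"
  assumes ge: "g \<bullet> e = 1" and A: "finite A" "A \<noteq> {}" "prj e g ` A \<subseteq> U" and U: "subspace U" "dim U < m"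
    and W: "zm.subspace W"
    and small: "\<And>B. B \<subseteq> A \<Longrightarrow> B \<noteq> {} \<Longrightarrow> card B \<le> m \<Longrightarrow> rho e g (supp (convex hull B)) \<in> W"
  shows "rho e g (supp (convex hull A)) \<in> W"
  using A small
proof (induction A rule: finite_psubset_induct)
  case (psubset A)
  let ?r = "\<lambda>B. rho e g (supp (convex hull B))"
  show ?case
  proof (cases "card A \<le> m")
    case True
    then show ?thesis using psubset.prems by blast
  next
    case False
    then have "dim U + 1 < card A" using U by simp
    from radon_linear_image[OF linear_prj psubset.hyps(1) psubset.prems(2) U(1) this]
    obtain M N p q where MN: "M \<subseteq> A" "N \<subseteq> A" "M \<inter> N = {}" "p \<in> convex hull M" "q \<in> convex hull N"
      "prj e g p = prj e g q" by blast
    have key: "?r A \<in> W" if MN: "M \<subseteq> A" "N \<subseteq> A" "M \<inter> N = {}" "p \<in> convex hull M" "q \<in> convex hull N"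
      "prj e g p = prj e g q" and le: "g \<bullet> q \<le> g \<bullet> p" for M N p q
    proof -
      \<comment> \<open>All points outside N are taken, not only M, so that the term T = N is the
        one of A itself.\<close>
      define I where "I = A - N"
      have ne: "M \<noteq> {}" "N \<noteq> {}" using MN by auto
      have I: "M \<subseteq> I" "I \<inter> N = {}" "I \<union> N = A" using MN by (auto simp: I_def)
      have "finite N" using MN psubset.hyps finite_subset by blast
      have "p \<in> convex hull I" using MN(4) I(1) hull_mono by blast
      then have rel: "(\<Sum>T\<in>Pow N. int_scale ((-1) ^ card T) (?r (I \<union> T))) = 0"
        using psubset.hyps \<open>finite N\<close> I MN le by (intro rho_radon_relation[OF ge, of I N p q]) (auto simp: I_def)
      have "(\<Sum>T\<in>Pow N - {N}. int_scale ((-1) ^ card T) (?r (I \<union> T))) \<in> W"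
      proof (intro zm.subspace_sum zm.subspace_scale W)
        fix T assume T: "T \<in> Pow N - {N}"
        then have "I \<union> T \<subset> A" using I by blast
        moreover have "I \<union> T \<noteq> {}" using ne I by blast
        ultimately show "?r (I \<union> T) \<in> W"
        proof (rule psubset.IH)
          show "prj e g ` (I \<union> T) \<subseteq> U" using psubset.prems(2) \<open>I \<union> T \<subset> A\<close> by blast
          show "?r B \<in> W" if "B \<subseteq> I \<union> T" "B \<noteq> {}" "card B \<le> m" for B
            by (rule psubset.prems(3)) (use that \<open>I \<union> T \<subset> A\<close> in blast)+
        qed
      qed
      moreover have "int_scale ((-1) ^ card N) (?r A) = - (\<Sum>T\<in>Pow N - {N}. int_scale ((-1) ^ card T) (?r (I \<union> T)))"
        using rel \<open>finite N\<close> I(3) by (simp add: sum.remove[of "Pow N" N] eq_neg_iff_add_eq_0)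
      \<comment> \<open>The sign is its own inverse, so applying it twice leaves the bare
        term.\<close>
      ultimately have "int_scale ((-1) ^ card N) (int_scale ((-1) ^ card N) (?r A)) \<in> W"
        using W by (auto intro!: zm.subspace_scale zm.subspace_neg)
      then show "?r A \<in> W" by (simp add: power_mult_distrib[symmetric])
    qed
    \<comment> \<open>The higher of the two points may belong to either half of the
      partition.\<close>
    show ?thesis
    proof (cases "g \<bullet> q \<le> g \<bullet> p")
      case True
      then show ?thesis using key[OF MN] by simp
    next
      case False
      then show ?thesis using key[of N M q p] MN by (simp add: Int_commute)
    qed
  qed
qed

section \<open>Splitting along \<open>e\<close>, and shadows as polytopes\<close>

lemma supp_prj:
  assumes "ipoly_in G P"
  shows "supp (prj e g ` P) x = supp P (x - (x \<bullet> e) *\<^sub>R g)"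
proof -
  have *: "x \<bullet> prj e g y = (x - (x \<bullet> e) *\<^sub>R g) \<bullet> y" for y by (simp add: prj_def algebra_simps)
  show ?thesis by (simp add: supp_def image_image *)
qed

text \<open>On each side of the wall \<open>x \<bullet> e = 0\<close> one tilt is the identity and
  the other is the projecting branch, which the last term cancels. This trades one tilt for the
  opposite one.\<close>

lemma supp_split:
  assumes "ipoly_in G P"
  shows "supp P = rho e g (supp P) + rho (- e) (- g) (supp P) - supp (prj e g ` P)"
  by (auto simp: fun_eq_iff rho_def tilt_def supp_prj[OF assms])

text \<open>The base is at height g = 0, so the picture is right for F at nonnegative height;
  \<open>raise\<close> arranges this.\<close>

definition shadow :: "real^'n::finite \<Rightarrow> real^'n \<Rightarrow> (real^'n) set \<Rightarrow> (real^'n) set" where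
  "shadow e g F = {x - s *\<^sub>R e | x s. x \<in> F \<and> 0 \<le> s \<and> s \<le> g \<bullet> x}"

text \<open>On a fibre, a direction that does not decrease along e is maximal at s = 0, that is on
  F, and any other at the base. These are the two branches of \<open>tilt\<close>.\<close>

lemma supp_shadow:
  assumes F: "ipoly_in G F" and pos: "\<And>x. x \<in> F \<Longrightarrow> 0 \<le> g \<bullet> x"
  shows "supp (shadow e g F) = rho e g (supp F)"
proof
  fix u
  from ipoly_attains[OF F, of "tilt e g u"]
  obtain x where x: "x \<in> F" "\<And>y. y \<in> F \<Longrightarrow> tilt e g u \<bullet> y \<le> tilt e g u \<bullet> x"
    "supp F (tilt e g u) = tilt e g u \<bullet> x" by blast
  show "supp (shadow e g F) u = rho e g (supp F) u"
  proof (cases "u \<bullet> e \<ge> 0")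
    case True
    then have t: "tilt e g u = u" by (simp add: tilt_def)
    have "supp (shadow e g F) u = u \<bullet> x"
    proof (rule supp_eqI)
      show "x \<in> shadow e g F" using x(1) pos by (force simp: shadow_def intro: exI[of _ 0])
      show "u \<bullet> y \<le> u \<bullet> x" if "y \<in> shadow e g F" for y
      proof -
        obtain z s where "y = z - s *\<^sub>R e" "z \<in> F" "0 \<le> s" using \<open>y \<in> _\<close> by (auto simp: shadow_def)
        moreover have "0 \<le> s * (u \<bullet> e)" using \<open>0 \<le> s\<close> True by simp
        ultimately show ?thesis using x(2)[of z] by (simp add: t inner_diff_right)
      qed
    qed
    then show ?thesis using x(3) by (simp add: rho_def t)
  next
    case False
    then have t: "tilt e g u \<bullet> y = u \<bullet> prj e g y" for y by (simp add: inner_tilt_neg)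
    have "supp (shadow e g F) u = u \<bullet> prj e g x"
    proof (rule supp_eqI)
      show "prj e g x \<in> shadow e g F" using x(1) pos by (auto simp: shadow_def prj_def)
      show "u \<bullet> y \<le> u \<bullet> prj e g x" if y: "y \<in> shadow e g F" for y
      proof -
        obtain z s where z: "y = z - s *\<^sub>R e" "z \<in> F" "0 \<le> s" "s \<le> g \<bullet> z" using y by (auto simp: shadow_def)
        then have "u \<bullet> y = u \<bullet> z + s * (- (u \<bullet> e))" by (simp add: inner_diff_right)
        also have "\<dots> \<le> u \<bullet> z + (g \<bullet> z) * (- (u \<bullet> e))" using False z(4) by (intro add_left_mono mult_right_mono) auto
        also have "\<dots> = u \<bullet> prj e g z" by (simp add: prj_def inner_diff_right)
        also have "\<dots> \<le> u \<bullet> prj e g x" using x(2)[OF z(2)] by (simp add: t)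
        finally show ?thesis .
      qed
    qed
    then show ?thesis using x(3) by (simp add: rho_def t)
  qed
qed

lemma convex_shadow:
  assumes "convex F"
  shows "convex (shadow e g F)"
  unfolding convex_alt
proof (intro ballI allI impI)
  fix a b t assume ab: "a \<in> shadow e g F" "b \<in> shadow e g F" and t: "0 \<le> t \<and> t \<le> (1::real)"
  obtain x s y r where a: "a = x - s *\<^sub>R e" "x \<in> F" "0 \<le> s" "s \<le> g \<bullet> x"
    and b: "b = y - r *\<^sub>R e" "y \<in> F" "0 \<le> r" "r \<le> g \<bullet> y" using ab by (auto simp: shadow_def)
  have "(1 - t) *\<^sub>R a + t *\<^sub>R b = ((1 - t) *\<^sub>R x + t *\<^sub>R y) - ((1 - t) * s + t * r) *\<^sub>R e"
    by (simp add: a b algebra_simps)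
  moreover have "(1 - t) *\<^sub>R x + t *\<^sub>R y \<in> F" using assms a b t by (simp add: convex_alt)
  moreover have "(1 - t) * s + t * r \<le> g \<bullet> ((1 - t) *\<^sub>R x + t *\<^sub>R y)"
    using a b t by (auto simp: inner_add_right intro!: add_mono mult_left_mono)
  moreover have "0 \<le> (1 - t) * s + t * r" using a b t by simp
  ultimately show "(1 - t) *\<^sub>R a + t *\<^sub>R b \<in> shadow e g F" unfolding shadow_def by blast
qed

lemma shadow_hull:
  assumes "finite S" "\<And>x. x \<in> S \<Longrightarrow> 0 \<le> g \<bullet> x"
  shows "shadow e g (convex hull S) = convex hull (S \<union> prj e g ` S)"
proof
  have S: "x \<in> S \<Longrightarrow> x \<in> convex hull S" for x by (rule hull_inc)
  have "x \<in> shadow e g (convex hull S)" if "x \<in> S" for x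
    using S[OF that] assms(2)[OF that] by (force simp: shadow_def intro: exI[of _ 0])
  moreover have "prj e g x \<in> shadow e g (convex hull S)" if "x \<in> S" for x
    using S[OF that] assms(2)[OF that] by (auto simp: shadow_def prj_def)
  ultimately show "convex hull (S \<union> prj e g ` S) \<subseteq> shadow e g (convex hull S)"
    by (intro hull_minimal convex_shadow) auto
  show "shadow e g (convex hull S) \<subseteq> convex hull (S \<union> prj e g ` S)"
  proof
    fix y assume "y \<in> shadow e g (convex hull S)"
    then obtain x s where x: "y = x - s *\<^sub>R e" "x \<in> convex hull S" "0 \<le> s" "s \<le> g \<bullet> x"
      by (auto simp: shadow_def)
    have 1: "x \<in> convex hull (S \<union> prj e g ` S)" using x(2) hull_mono by (metis Un_upper1 subsetD)
    have "prj e g x \<in> convex hull (prj e g ` S)"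
      using x(2) convex_hull_linear_image[OF linear_prj] by blast
    then have 2: "prj e g x \<in> convex hull (S \<union> prj e g ` S)" using hull_mono by (metis Un_upper2 subsetD)
    \<comment> \<open>At height 0 also s is 0, and division by zero gives the right value t =
      0.\<close>
    define t where "t = s / (g \<bullet> x)"
    have t: "0 \<le> t" "t \<le> 1" "s = t * (g \<bullet> x)"
      using x(3,4) by (auto simp: t_def divide_le_eq_1)
    then have "y = (1 - t) *\<^sub>R x + t *\<^sub>R prj e g x" by (simp add: x(1) prj_def algebra_simps)
    then show "y \<in> convex hull (S \<union> prj e g ` S)"
      using 1 2 t(1,2) convex_convex_hull[of "S \<union> prj e g ` S"] unfolding convex_alt by blast
  qed
qed

lemma ipoly_in_shadow:
  assumes F: "ipoly_in G F" and pos: "\<And>x. x \<in> F \<Longrightarrow> 0 \<le> g \<bullet> x" and "G \<subseteq> H" "\<And>x. x \<in> G \<Longrightarrow> prj e g x \<in> H"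
  shows "ipoly_in H (shadow e g F)"
proof -
  obtain S where S: "finite S" "S \<noteq> {}" "S \<subseteq> G" "F = convex hull S" using F by (rule ipoly_inE)
  have "shadow e g F = convex hull (S \<union> prj e g ` S)"
    unfolding S(4) by (rule shadow_hull) (use S pos in \<open>auto simp: hull_inc\<close>)
  moreover have "S \<union> prj e g ` S \<subseteq> H" using S(3) assms(3,4) by blast
  ultimately show ?thesis using S ipoly_in_hull[of "S \<union> prj e g ` S" H] by simp
qed

lemma par_shadow: 
  assumes "subspace U" "par F U" "e \<in> U"
  shows "par (shadow e g F) U"
  unfolding par_def
proof (intro ballI)
  fix a b assume "a \<in> shadow e g F" "b \<in> shadow e g F"
  then obtain x s y r where a: "a = x - s *\<^sub>R e" "x \<in> F" and b: "b = y - r *\<^sub>R e" "y \<in> F"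
    by (auto simp: shadow_def)
  have "a - b = (x - y) + (r - s) *\<^sub>R e" by (simp add: a b algebra_simps)
  moreover have "x - y \<in> U" using assms(2) a(2) b(2) by (auto simp: par_def)
  ultimately show "a - b \<in> U" using assms(1,3) subspace_add subspace_scale by metis
qed

lemma aff_dim_shadow_le: "aff_dim (shadow e g F) \<le> aff_dim F + 1"
proof (cases "F = {}")
  case True
  then show ?thesis by (simp add: shadow_def)
next
  case False
  let ?U = "span (insert e (dirspace F))"
  have "par (shadow e g F) ?U"
    by (rule par_shadow) (auto intro: par_mono[OF par_dirspace] span_base)
  then have "aff_dim (shadow e g F) \<le> int (dim ?U)" by (intro aff_dim_par_le) auto
  also have "dim ?U \<le> dim (dirspace F) + 1" by (simp add: dim_insert)
  finally show ?thesis using dim_dirspace[OF False] by simp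
qed

text \<open>At constant height k the shadow is the prism P + k [0, -e]. As an identity of functions
  this makes sense for negative k too.\<close>

lemma rho_supp_flat:
  assumes P: "ipoly_in G P" and flat: "\<And>y. y \<in> P \<Longrightarrow> g \<bullet> y = of_int k"
  shows "rho e g (supp P) = supp P + int_scale k (supp (convex hull {0, - e}))"
proof
  fix x
  from ipoly_attains[OF P, of x]
  obtain y where y: "y \<in> P" "\<And>z. z \<in> P \<Longrightarrow> x \<bullet> z \<le> x \<bullet> y" "supp P x = x \<bullet> y" by blast
  have "supp P (x - (x \<bullet> e) *\<^sub>R g) = (x - (x \<bullet> e) *\<^sub>R g) \<bullet> y"
    by (rule supp_eqI) (use y flat in \<open>auto simp: inner_diff_left\<close>)
  then show "rho e g (supp P) x = (supp P + int_scale k (supp (convex hull {0, - e}))) x"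
    using y(1,3) flat by (auto simp: rho_def tilt_def supp_hull inner_diff_left)
qed

subsection \<open>Functionals detecting a direction space\<close>

text \<open>A functional that sees only the direction space U among polytopes of dimension at most
  \<open>dim U\<close>. Its values in higher dimension are left open, which is why relations are
  tested at their top dimension.\<close>

definition dimfun :: "(real^'n::finite) set \<Rightarrow> ((real^'n) set \<Rightarrow> real) \<Rightarrow> bool" where
  "dimfun U c \<longleftrightarrow>
     (\<forall>P Q. ipoly_in zlat P \<longrightarrow> ipoly_in zlat Q \<longrightarrow> c (msum P Q) = c P + c Q) \<and>
     (\<forall>P. ipoly_in zlat P \<longrightarrow> aff_dim P \<le> int (dim U) \<longrightarrow> \<not> (aff_dim P = int (dim U) \<and> par P U) \<longrightarrow> c P = 0)"

lemma dimfun_add: "dimfun U c \<Longrightarrow> ipoly_in zlat P \<Longrightarrow> ipoly_in zlat Q \<Longrightarrow> c (msum P Q) = c P + c Q"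
  and dimfun_low: "dimfun U c \<Longrightarrow> ipoly_in zlat P \<Longrightarrow> aff_dim P < int (dim U) \<Longrightarrow> c P = 0"
  and dimfun_not_par: "dimfun U c \<Longrightarrow> ipoly_in zlat P \<Longrightarrow> aff_dim P \<le> int (dim U) \<Longrightarrow> \<not> par P U \<Longrightarrow> c P = 0"
  by (auto simp: dimfun_def)

lemma dimfun_other:
  assumes "dimfun U c" "ipoly_in zlat P" "par P V" "subspace U" "subspace V" "dim V \<le> dim U" "V \<noteq> U"
  shows "c P = 0"
proof (cases "par P U")
  case True
  then have "aff_dim P < int (dim U)" using assms by (intro aff_dim_par_two[of V U]) auto
  then show ?thesis using assms dimfun_low by blast
next
  case False
  have "aff_dim P \<le> int (dim V)" using assms by (intro aff_dim_par_le) auto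
  then show ?thesis using False assms by (intro dimfun_not_par[of U]) auto
qed

text \<open>Translation is Minkowski addition of a point, and a point has dimension below
  \<open>dim U\<close>. So the functional descends to P_T.\<close>

lemma dimfun_translate:
  assumes "dimfun U c" "ipoly_in zlat P" "v \<in> zlat" "dim U \<ge> 1"
  shows "c ((\<lambda>x. x + v) ` P) = c P"
proof -
  have "c {v} = 0" using assms by (intro dimfun_low[of U] ipoly_in_sing) auto
  moreover have "c (msum P {v}) = c P + c {v}" using assms by (intro dimfun_add[of U] ipoly_in_sing) auto
  ultimately show ?thesis by (simp add: msum_sing)
qed

text \<open>A face of dimension \<open>dim U\<close> would have the affine hull of P. As the face is
  parallel to U, so would be P, against the assumption.\<close>

lemma aff_dim_generic_face:
  assumes P: "ipoly_in zlat P" and U: "subspace U"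
    and w: "\<And>z. z \<in> zlat \<Longrightarrow> w \<bullet> z = 0 \<Longrightarrow> z \<in> U"
    and le: "aff_dim P \<le> int (dim U)" and not: "\<not> (aff_dim P = int (dim U) \<and> par P U)"
  shows "aff_dim (face w P) < int (dim U)"
proof (rule ccontr)
  assume ge: "\<not> aff_dim (face w P) < int (dim U)"
  have "aff_dim (face w P) \<le> aff_dim P" by (rule aff_dim_subset[OF face_subset])
  then have eq: "aff_dim (face w P) = aff_dim P" "aff_dim P = int (dim U)" using ge le by auto
  have "face w P \<noteq> {}" using face_ipoly_in[OF P] by (rule ipoly_in_nonempty)
  then have "par P U" using par_extend[OF face_subset _ eq(1) U par_face[OF P U w]] by blast
  then show False using eq not by simp
qed

text \<open>\<open>face w\<close> isolates the direction space U; then the faces in the two opposite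
  directions normal to V are compared. One of them alone would not do: a polytope parallel to V is
  its own face in both directions, and only the difference kills it.\<close>

definition facet_diff :: "((real^'n::finite) set \<Rightarrow> real) \<Rightarrow> real^'n \<Rightarrow> real^'n \<Rightarrow> (real^'n) set \<Rightarrow> real" where
  "facet_diff c u w P = c (face u (face w P)) - c (face (- u) (face w P))"

lemma dimfun_facet_diff:
  fixes U :: "(real^'n::finite) set"
  assumes U: "subspace U" and V: "subspace V" and dim: "dim U = dim V + 1"
    and w: "\<And>z. z \<in> zlat \<Longrightarrow> w \<bullet> z = 0 \<Longrightarrow> z \<in> U"
    and uV: "\<And>x. x \<in> V \<Longrightarrow> u \<bullet> x = 0" and uU: "\<And>x. x \<in> U \<Longrightarrow> u \<bullet> x = 0 \<Longrightarrow> x \<in> V"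
    and c: "dimfun V c"
  shows "dimfun U (facet_diff c u w)"
  unfolding dimfun_def
proof (intro conjI allI impI)
  fix P Q :: "(real^'n) set" assume "ipoly_in zlat P" "ipoly_in zlat Q"
  then show "facet_diff c u w (msum P Q) = facet_diff c u w P + facet_diff c u w Q"
    by (simp add: facet_diff_def face_msum dimfun_add[OF c] face_ipoly_in)
next
  fix P :: "(real^'n) set"
  assume P: "ipoly_in zlat P" "aff_dim P \<le> int (dim U)" "\<not> (aff_dim P = int (dim U) \<and> par P U)"
  define F where "F = face w P"
  have F: "ipoly_in zlat F" using P(1) by (simp add: F_def face_ipoly_in)
  have "aff_dim F < int (dim U)" unfolding F_def using P U w by (intro aff_dim_generic_face) auto
  then have Fdim: "aff_dim F \<le> int (dim V)" using dim by simp
  have Fpar: "par F U" unfolding F_def using P U w by (intro par_face) auto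
  show "facet_diff c u w P = 0"
  proof (cases "par F V")
    case True
    have "face u F = F" "face (- u) F = F"
      by (rule face_eq_self; use True uV in \<open>auto simp: par_def\<close>)+
    then show ?thesis by (simp add: facet_diff_def F_def[symmetric])
  next
    case False
    have "c (face s F) = 0" if s: "s = u \<or> s = - u" for s
    proof -
      have G: "ipoly_in zlat (face s F)" using F by (rule face_ipoly_in)
      have "x - y \<in> V" if "x \<in> face s F" "y \<in> face s F" for x y
      proof (rule uU)
        show "x - y \<in> U" using that Fpar by (auto simp: par_def face_def)
        have "s \<bullet> x = s \<bullet> y" using that by (force simp: face_def)
        then show "u \<bullet> (x - y) = 0" using s by (auto simp: inner_diff_right)
      qed
      then have par: "par (face s F) V" by (simp add: par_def)
      have "aff_dim (face s F) \<le> aff_dim F" by (rule aff_dim_subset[OF face_subset])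
      moreover have "aff_dim (face s F) \<noteq> aff_dim F"
        using par_extend[OF face_subset ipoly_in_nonempty[OF G] _ V par] False by blast
      ultimately have "aff_dim (face s F) < int (dim V)" using Fdim by simp
      then show ?thesis using c G by (rule dimfun_low[rotated 2])
    qed
    then show ?thesis by (simp add: facet_diff_def F_def[symmetric])
  qed
qed

text \<open>u is the component of e orthogonal to V, whence
  \<open>u \<bullet> e = u \<bullet> u\<close>; and U is spanned by V and e.\<close>

lemma facet_normal:
  fixes U V :: "'a::euclidean_space set"
  assumes U: "subspace U" and V: "subspace V" "V \<subseteq> U" "dim U = dim V + 1" and e: "e \<in> U" "e \<notin> V"
  obtains u where "\<And>x. x \<in> V \<Longrightarrow> u \<bullet> x = 0" "\<And>x. x \<in> U \<Longrightarrow> u \<bullet> x = 0 \<Longrightarrow> x \<in> V" "u \<bullet> e > 0"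
proof -
  have sV: "span V = V" using V by (simp add: span_eq_iff)
  obtain y u where yu: "y \<in> V" "\<And>x. x \<in> V \<Longrightarrow> orthogonal u x" "e = y + u"
    using orthogonal_subspace_decomp_exists[of V e] sV by metis
  have "u \<bullet> y = 0" using yu by (simp add: orthogonal_def)
  then have ue: "u \<bullet> e = u \<bullet> u" by (simp add: yu(3) inner_add_right)
  have "u \<noteq> 0" using yu e by auto
  then have pos: "u \<bullet> e > 0" using ue by simp
  have "span (insert e V) = U"
  proof (rule subspace_dim_equal)
    show "span (insert e V) \<subseteq> U" using U V e by (intro span_minimal) auto
    show "dim U \<le> dim (span (insert e V))" using V(3) e(2) unfolding dim_span dim_insert sV by simp
  qed (use U in auto)
  then have ex: "\<exists>k. x - k *\<^sub>R e \<in> V" if "x \<in> U" for x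
    using that span_breakdown_eq[of x e V] sV by auto
  show thesis
  proof
    show "u \<bullet> x = 0" if "x \<in> V" for x using yu(2)[OF that] by (simp add: orthogonal_def)
    show "x \<in> V" if x: "x \<in> U" "u \<bullet> x = 0" for x
    proof -
      obtain k where k: "x - k *\<^sub>R e \<in> V" using ex x by blast
      then have "u \<bullet> (x - k *\<^sub>R e) = 0" using yu(2) by (simp add: orthogonal_def)
      then have "k = 0" using x pos by (simp add: inner_diff_right)
      then show ?thesis using k by simp
    qed
  qed (rule pos)
qed

subsection \<open>A basis for each rational subspace\<close>

definition lowsupp :: "(real^'n::finite) set \<Rightarrow> nat \<Rightarrow> (real^'n \<Rightarrow> real) set" where
  "lowsupp G m = {supp P | P. ipoly_in G P \<and> aff_dim P < int m}"

text \<open>Dual functionals stand in for independence modulo lower dimension, because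
  \<open>facet_diff\<close> carries them from a hyperplane V to U. The elements are polytopes, not
  classes, so that shadows can be formed.\<close>

definition local_basis :: "(real^'n::finite) set \<Rightarrow> (real^'n) set set \<Rightarrow> bool" where
  "local_basis U B \<longleftrightarrow>
     (\<forall>b\<in>B. ipoly_in (U \<inter> zlat) b \<and> aff_dim b = int (dim U)) \<and>
     (\<forall>b\<in>B. \<exists>c. dimfun U c \<and> c b = 1 \<and> (\<forall>b'\<in>B. b' \<noteq> b \<longrightarrow> c b' = 0)) \<and>
     (\<forall>P. ipoly_in (U \<inter> zlat) P \<longrightarrow> supp P \<in> zm.span (lowsupp (U \<inter> zlat) (dim U) \<union> supp ` B))"

text \<open>For a coordinate i that is not identically zero on the lattice of U, take e with least
  positive i-th coordinate d. Division with remainder shows that d divides all i-th coordinates, so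
  g can be the i-th coordinate over d.\<close>

lemma primitive_coordinate:
  fixes U :: "(real^'n::finite) set"
  assumes U: "ratsub U" "dim U \<ge> 1"
  obtains e g where "e \<in> U \<inter> zlat" "g \<bullet> e = 1" "\<And>x. x \<in> U \<inter> zlat \<Longrightarrow> g \<bullet> x \<in> \<int>"
proof -
  have "\<exists>z\<in>U \<inter> zlat. z \<noteq> 0"
  proof (rule ccontr)
    assume "\<not> (\<exists>z\<in>U \<inter> zlat. z \<noteq> 0)"
    then have "U \<inter> zlat \<subseteq> {0}" by blast
    then have "dim (U \<inter> zlat) = 0" by (metis dim_eq_0)
    moreover have "dim U = dim (U \<inter> zlat)" using U(1) by (metis dim_span ratsub_def)
    ultimately show False using U(2) by linarith
  qed
  then obtain z i where z: "z \<in> U \<inter> zlat" "z $ i \<noteq> 0" by (auto simp: vec_eq_iff)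
  have sub: "subspace U" using U by (simp add: ratsub_def)
  define D where "D n \<longleftrightarrow> n > 0 \<and> (\<exists>x\<in>U \<inter> zlat. x $ i = real n)" for n :: nat
  have "\<exists>n. D n"
  proof -
    obtain k where k: "z $ i = of_int k" using z by (auto simp: zlat_def elim: Ints_cases)
    have "- z \<in> U \<inter> zlat" using z sub by (simp add: subspace_neg zlat_minus)
    then have "\<exists>x\<in>U \<inter> zlat. x $ i = real (nat \<bar>k\<bar>)"
      using z(1) k by (cases "k \<ge> 0") (auto intro: bexI[of _ z] bexI[of _ "- z"])
    then show ?thesis using k z(2) by (auto simp: D_def intro!: exI[of _ "nat \<bar>k\<bar>"])
  qed
  define d where "d = (LEAST n. D n)"
  have "D d" unfolding d_def using \<open>\<exists>n. D n\<close> by (rule LeastI_ex)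
  then obtain e where e: "e \<in> U \<inter> zlat" "e $ i = real d" and d: "d > 0" by (auto simp: D_def)
  have dvd: "x $ i / real d \<in> \<int>" if x: "x \<in> U \<inter> zlat" for x
  proof -
    obtain k where k: "x $ i = of_int k" using x by (auto simp: zlat_def elim: Ints_cases)
    define r where "r = nat (k mod int d)"
    let ?y = "x - of_int (k div int d) *\<^sub>R e"
    have "?y \<in> U \<inter> zlat" using x e sub by (simp add: zlat_diff zlat_scale subspace_diff subspace_scale)
    moreover have "?y $ i = real r"
    proof -
      have "k - k div int d * int d = k mod int d" by (simp add: minus_div_mult_eq_mod)
      then have "of_int k - of_int (k div int d) * real d = of_int (k mod int d)"
        by (metis of_int_diff of_int_mult of_int_of_nat_eq)
      then show ?thesis using d by (simp add: k e(2) r_def)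
    qed
    moreover have "\<not> D r"
    proof
      assume "D r"
      then have "d \<le> r" unfolding d_def by (rule Least_le)
      moreover have "k mod int d < int d" using d by simp
      moreover have "0 \<le> k mod int d" using d by simp
      ultimately show False by (simp add: r_def le_nat_iff)
    qed
    ultimately have "r = 0" unfolding D_def by (metis gr0I)
    then have "k mod int d = 0" using d by (intro antisym) (simp_all add: r_def)
    then obtain q where "k = int d * q" by auto
    then show ?thesis using d by (simp add: k)
  qed
  show thesis
  proof (rule that)
    show "e \<in> U \<inter> zlat" by (rule e)
    show "axis i (1 / real d) \<bullet> e = 1" using e d by (simp add: inner_axis')
    show "axis i (1 / real d) \<bullet> x \<in> \<int>" if "x \<in> U \<inter> zlat" for x
      using dvd[OF that] by (simp add: inner_axis')
  qed
qed

text \<open>On a line every lattice polytope is a translate of an integer multiple of the primitive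
  segment [0, e], which therefore forms the whole basis.\<close>

lemma local_basis_1:
  fixes U :: "(real^'n::finite) set"
  assumes U: "ratsub U" "dim U = 1"
  shows "\<exists>B. local_basis U B"
proof -
  have sub: "subspace U" using U by (simp add: ratsub_def)
  obtain e g where e: "e \<in> U \<inter> zlat" and ge: "g \<bullet> e = 1" and gZ: "\<And>x. x \<in> U \<inter> zlat \<Longrightarrow> g \<bullet> x \<in> \<int>"
    using primitive_coordinate[of U] U by auto
  obtain w where w: "\<And>x. x \<in> U \<Longrightarrow> w \<bullet> x = 0" "\<And>z. z \<in> zlat \<Longrightarrow> w \<bullet> z = 0 \<Longrightarrow> z \<in> U"
    using generic_normal[OF sub] by blast
  have "e \<noteq> 0" using ge by auto
  have "span {e} = U"
  proof (rule subspace_dim_equal)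
    show "span {e} \<subseteq> U" using e sub by (intro span_minimal) auto
    show "dim U \<le> dim (span {e})" using U(2) \<open>e \<noteq> 0\<close> by (simp add: dim_insert)
  qed (use sub in auto)
  then have Ue: "x = (g \<bullet> x) *\<^sub>R e" if "x \<in> U" for x
    using that ge by (auto simp: span_singleton)
  define b where "b = convex hull {0, e}"
  have b: "ipoly_in (U \<inter> zlat) b" unfolding b_def using e sub by (intro ipoly_in_hull) (auto simp: subspace_0)
  have bz: "ipoly_in zlat b" using b by (rule ipoly_in_mono) auto
  \<comment> \<open>The width of the generic face in direction g: its lattice length, 1 on
    \<open>b\<close> and 0 on points.\<close>
  define c where "c P = supp (face w P) g + supp (face w P) (- g)" for P
  have "dimfun U c" unfolding dimfun_def
  proof (intro conjI allI impI)
    fix P Q :: "(real^'n) set" assume "ipoly_in zlat P" "ipoly_in zlat Q"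
    then have "supp (face w (msum P Q)) = supp (face w P) + supp (face w Q)"
      by (simp add: face_msum supp_msum[of zlat] face_ipoly_in)
    then show "c (msum P Q) = c P + c Q" by (simp add: c_def)
  next
    fix P :: "(real^'n) set"
    assume P: "ipoly_in zlat P" "aff_dim P \<le> int (dim U)" "\<not> (aff_dim P = int (dim U) \<and> par P U)"
    have "aff_dim (face w P) < int (dim U)" using P sub w by (intro aff_dim_generic_face) auto
    moreover have "face w P \<noteq> {}" using face_ipoly_in[OF P(1)] by (rule ipoly_in_nonempty)
    ultimately have "aff_dim (face w P) = 0"
      using U(2) aff_dim_negative_iff[of "face w P"] by linarith
    then obtain a where "face w P = {a}" by (auto simp: aff_dim_eq_0)
    then show "c P = 0" by (simp add: c_def supp_sing lin_def)
  qed
  moreover have "c b = 1"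
  proof -
    have "par b U" using sub b by (intro par_ipoly_in[of U "U \<inter> zlat"]) auto
    then have "face w b = b" by (intro face_eq_self) (auto simp: par_def w)
    then show ?thesis by (simp add: c_def b_def supp_hull ge)
  qed
  moreover have "supp P \<in> zm.span (lowsupp (U \<inter> zlat) (dim U) \<union> supp ` {b})" if P: "ipoly_in (U \<inter> zlat) P" for P
  proof -
    obtain S where S: "finite S" "S \<noteq> {}" "S \<subseteq> U \<inter> zlat" "P = convex hull S" using P by (rule ipoly_inE)
    have "Min ((\<bullet>) g ` S) \<in> (\<bullet>) g ` S" "Max ((\<bullet>) g ` S) \<in> (\<bullet>) g ` S" using S by auto
    then obtain s t where st: "s \<in> S" "t \<in> S" "g \<bullet> s = Min ((\<bullet>) g ` S)" "g \<bullet> t = Max ((\<bullet>) g ` S)" by auto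
    have le: "g \<bullet> s \<le> g \<bullet> x" "g \<bullet> x \<le> g \<bullet> t" if "x \<in> S" for x using that S(1) st by auto
    have inU: "x \<in> U \<inter> zlat" if "x \<in> S" for x using that S(3) by blast
    have "g \<bullet> t - g \<bullet> s \<in> \<int>" by (intro Ints_diff gZ inU st)
    then obtain k where k: "g \<bullet> t - g \<bullet> s = of_int k" by (auto elim: Ints_cases)
    have "k \<ge> 0" using le(1)[OF st(2)] k by simp
    \<comment> \<open>s and t are the end points in the order of g, and k is the lattice length of
      P.\<close>
    have "supp P = lin s + int_scale k (supp b)"
    proof
      fix x
      have xe: "x \<bullet> y = (g \<bullet> y) * (x \<bullet> e)" if "y \<in> S" for y
        using arg_cong[OF Ue[of y], of "\<lambda>z. x \<bullet> z"] that inU by auto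
      show "supp P x = (lin s + int_scale k (supp b)) x"
      proof (cases "x \<bullet> e \<ge> 0")
        case True
        have "Max ((\<bullet>) x ` S) = x \<bullet> t"
        proof (rule Max_eqI)
          show "y \<le> x \<bullet> t" if "y \<in> (\<bullet>) x ` S" for y
            using that st(1,2) le(2) True by (auto simp: xe intro!: mult_right_mono)
        qed (use S st in auto)
        moreover have "of_int k * (x \<bullet> e) = x \<bullet> t - x \<bullet> s"
          using st by (simp add: xe k[symmetric] algebra_simps)
        ultimately show ?thesis using S True by (simp add: supp_hull lin_def b_def)
      next
        case False
        have "Max ((\<bullet>) x ` S) = x \<bullet> s"
        proof (rule Max_eqI)
          show "y \<le> x \<bullet> s" if "y \<in> (\<bullet>) x ` S" for y
            using that st(1,2) le(1) False by (auto simp: xe intro!: mult_right_mono_neg)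
        qed (use S st in auto)
        then show ?thesis using S False by (simp add: supp_hull lin_def b_def)
      qed
    qed
    moreover have "lin s \<in> lowsupp (U \<inter> zlat) (dim U)"
      using inU[OF st(1)] U(2) by (auto simp: lowsupp_def supp_sing intro!: exI[of _ "{s}"] ipoly_in_sing)
    ultimately show ?thesis by (auto intro: zm.span_add zm.span_scale zm.span_base)
  qed
  moreover have "aff_dim b = int (dim U)"
    using U(2) \<open>e \<noteq> 0\<close> by (simp add: b_def aff_dim_convex_hull)
  ultimately have "local_basis U {b}" using b by (auto simp: local_basis_def)
  then show ?thesis by blast
qed

text \<open>\<open>supp P (- g)\<close> is minus the least height of P, so this lifts P to
  nonnegative height when \<open>g \<bullet> e = 1\<close>. Rounding up makes the shift an integer
  multiple of e.\<close>

definition raise :: "real^'n::finite \<Rightarrow> real^'n \<Rightarrow> (real^'n) set \<Rightarrow> (real^'n) set" where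
  "raise e g P = (\<lambda>x. x + of_int \<lceil>supp P (- g)\<rceil> *\<^sub>R e) ` P"

lemma raise_nonneg:
  assumes "ipoly_in G P" "g \<bullet> e = 1" "x \<in> raise e g P"
  shows "0 \<le> g \<bullet> x"
proof -
  obtain y where y: "y \<in> P" "x = y + of_int \<lceil>supp P (- g)\<rceil> *\<^sub>R e" using assms(3) by (auto simp: raise_def)
  have "- g \<bullet> y \<le> supp P (- g)" using assms(1) y(1) by (rule le_supp)
  also have "\<dots> \<le> of_int \<lceil>supp P (- g)\<rceil>" by simp
  finally show ?thesis by (simp add: y(2) inner_add_right assms(2))
qed

lemma supp_raise:
  assumes "ipoly_in G P"
  shows "supp (raise e g P) = supp P + lin (of_int \<lceil>supp P (- g)\<rceil> *\<^sub>R e)"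
  unfolding raise_def using assms by (rule supp_translate)

lemma ipoly_in_raise:
  assumes "ipoly_in G P" "\<And>x k. x \<in> G \<Longrightarrow> x + of_int k *\<^sub>R e \<in> H"
  shows "ipoly_in H (raise e g P)"
  unfolding raise_def by (rule translate_ipoly_in[OF assms(1)]) (rule assms(2))

lemma dirspace_hull: "dirspace (convex hull S) = dirspace S"
proof
  show "dirspace (convex hull S) \<subseteq> dirspace S"
    by (intro dirspace_minimal subspace_dirspace par_hull par_dirspace)
  show "dirspace S \<subseteq> dirspace (convex hull S)"
    by (intro dirspace_minimal subspace_dirspace par_subset[OF par_dirspace]) (rule hull_subset)
qed

text \<open>Moving one generating lattice point to the origin puts all of them into the direction
  space, where the local basis of that space can be applied.\<close>

lemma ipoly_in_dirspace:
  assumes P: "ipoly_in G P" and G: "G \<subseteq> zlat"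
  obtains a where "a \<in> G" "a \<in> P" "ipoly_in (dirspace P \<inter> zlat) ((\<lambda>x. x + (- a)) ` P)"
    "supp P = supp ((\<lambda>x. x + (- a)) ` P) + lin a" "ratsub (dirspace P)"
proof -
  obtain S where S: "finite S" "S \<noteq> {}" "S \<subseteq> G" "P = convex hull S" using P by (rule ipoly_inE)
  obtain a where a: "a \<in> S" using S by blast
  have "(\<lambda>x. x + (- a)) ` P = convex hull ((\<lambda>x. x + (- a)) ` S)"
    using convex_hull_translation[of "- a" S] by (simp add: S)
  moreover have "(\<lambda>x. x + (- a)) ` S \<subseteq> dirspace P \<inter> zlat"
  proof
    fix y assume "y \<in> (\<lambda>x. x + (- a)) ` S"
    then obtain x where x: "x \<in> S" "y = x - a" by auto
    then have "y \<in> dirspace P" using par_dirspace[of P] a S(4) by (auto simp: par_def hull_inc)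
    moreover have "y \<in> zlat" unfolding x(2) using x(1) a S(3) G by (intro zlat_diff) auto
    ultimately show "y \<in> dirspace P \<inter> zlat" by simp
  qed
  ultimately have "ipoly_in (dirspace P \<inter> zlat) ((\<lambda>x. x + (- a)) ` P)"
    using S ipoly_in_hull[of "(\<lambda>x. x + (- a)) ` S"] by simp
  moreover have "supp P = supp ((\<lambda>x. x + (- a)) ` P) + lin a"
    unfolding supp_translate[OF P] by (simp add: lin_def fun_eq_iff)
  moreover have "ratsub (dirspace P)"
    unfolding S(4) dirspace_hull using S(3) G by (intro ratsub_dirspace) auto
  moreover have "a \<in> G" "a \<in> P" using a S by (auto simp: hull_inc)
  ultimately show thesis using that by blast
qed

text \<open>In direction u the shadow is maximal only on F, in direction -u only on the projection
  of F. The projection is parallel to U0 and is killed by c because U0 differs from V; this is why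
  shadows over U0 are left out. The upper face is all of F for V' = V and is killed
  otherwise.\<close>

lemma facet_diff_shadow:
  fixes U :: "(real^'n::finite) set"
  assumes U: "subspace U" and V: "subspace V" and V': "subspace V'" "V' \<subseteq> U" and dim: "dim V' \<le> dim V"
    and w: "\<And>x. x \<in> U \<Longrightarrow> w \<bullet> x = 0"
    and uV: "\<And>x. x \<in> V \<Longrightarrow> u \<bullet> x = 0" and ue: "u \<bullet> e > 0"
    and c: "dimfun V c" and e: "e \<in> U \<inter> zlat"
    and F: "ipoly_in zlat F" "par F V'" and pos: "\<And>x. x \<in> F \<Longrightarrow> 0 \<le> g \<bullet> x"
    and U0: "subspace U0" "dim U0 \<le> dim V" "U0 \<noteq> V" "par (prj e g ` F) U0"
    and X: "ipoly_in zlat (shadow e g F)"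
  shows "facet_diff c u w (shadow e g F) = (if V' = V then c F else 0)"
proof -
  let ?X = "shadow e g F"
  have "par ?X U" using U e par_mono[OF F(2) V'(2)] by (intro par_shadow) auto
  then have w: "face w ?X = ?X" by (intro face_eq_self) (auto simp: par_def w)
  have FX: "x \<in> ?X" if "x \<in> F" for x
    using that pos[OF that] by (force simp: shadow_def intro: exI[of _ 0])
  have up: "face u ?X \<subseteq> F"
  proof
    fix a assume a: "a \<in> face u ?X"
    then obtain x s where x: "a = x - s *\<^sub>R e" "x \<in> F" "0 \<le> s" by (auto simp: face_def shadow_def)
    have "u \<bullet> x \<le> u \<bullet> a" using a FX[OF x(2)] by (auto simp: face_def)
    then have "s * (u \<bullet> e) \<le> 0" by (simp add: x(1) inner_diff_right)
    then have "s = 0" using ue x(3) by (simp add: mult_le_0_iff)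
    then show "a \<in> F" using x by simp
  qed
  have down: "face (- u) ?X \<subseteq> prj e g ` F"
  proof
    fix a assume a: "a \<in> face (- u) ?X"
    then obtain x s where x: "a = x - s *\<^sub>R e" "x \<in> F" "s \<le> g \<bullet> x" by (auto simp: face_def shadow_def)
    have "prj e g x \<in> ?X" using x(2) pos[OF x(2)] by (auto simp: shadow_def prj_def)
    then have "- u \<bullet> prj e g x \<le> - u \<bullet> a" using a by (auto simp: face_def)
    then have "(g \<bullet> x - s) * (u \<bullet> e) \<le> 0" by (simp add: x(1) prj_def inner_diff_right algebra_simps)
    then have "s = g \<bullet> x" using ue x(3) by (simp add: mult_le_0_iff)
    then show "a \<in> prj e g ` F" using x by (auto simp: prj_def)
  qed
  have "c (face (- u) ?X) = 0"
    by (rule dimfun_other[OF c face_ipoly_in[OF X] par_subset[OF U0(4) down] V U0(1-3)])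
  moreover have "c (face u ?X) = (if V' = V then c F else 0)"
  proof (cases "V' = V")
    case True
    have const: "u \<bullet> x = u \<bullet> y" if "x \<in> F" "y \<in> F" for x y
    proof -
      have "u \<bullet> (x - y) = 0" using uV F(2) True that by (auto simp: par_def)
      then show ?thesis by (simp add: inner_diff_right)
    qed
    have "F \<subseteq> face u ?X"
    proof
      fix x assume x: "x \<in> F"
      have "u \<bullet> a \<le> u \<bullet> x" if "a \<in> ?X" for a
      proof -
        obtain y s where y: "a = y - s *\<^sub>R e" "y \<in> F" "0 \<le> s" using \<open>a \<in> ?X\<close> by (auto simp: shadow_def)
        have "0 \<le> s * (u \<bullet> e)" using y ue by simp
        then show ?thesis using const[OF x y(2)] by (simp add: y(1) inner_diff_right)
      qed
      then show "x \<in> face u ?X" using FX[OF x] by (auto simp: face_def)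
    qed
    then show ?thesis using up True by simp
  next
    case False
    then show ?thesis
      using dimfun_other[OF c face_ipoly_in[OF X] par_subset[OF F(2) up] V V'(1) dim] by simp
  qed
  ultimately show ?thesis by (simp add: facet_diff_def w)
qed

section \<open>The induction step: shadows of the bases of hyperplanes\<close>

lemma local_basis_step:
  fixes U :: "(real^'n::finite) set"
  assumes U: "ratsub U" "dim U = Suc m" "m \<ge> 1"
    and IH: "\<And>V :: (real^'n) set. ratsub V \<Longrightarrow> dim V = m \<Longrightarrow> local_basis V (BB V)"
  shows "\<exists>B. local_basis U B"
proof -
  let ?G = "U \<inter> zlat"
  have sub: "subspace U" using U by (simp add: ratsub_def)
  obtain e g where e: "e \<in> ?G" and ge: "g \<bullet> e = 1" and gZ: "\<And>x. x \<in> ?G \<Longrightarrow> g \<bullet> x \<in> \<int>"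
    using primitive_coordinate[of U] U by auto
  have "e \<noteq> 0" using ge by auto
  obtain w where w: "\<And>x. x \<in> U \<Longrightarrow> w \<bullet> x = 0" "\<And>z. z \<in> zlat \<Longrightarrow> w \<bullet> z = 0 \<Longrightarrow> z \<in> U"
    using generic_normal[OF sub] by blast
  have G_shift: "x + of_int k *\<^sub>R e \<in> ?G" if "x \<in> ?G" for x k
    using that e sub by (simp add: zlat_add zlat_scale subspace_add subspace_scale)
  define U0 where "U0 = U \<inter> {x. g \<bullet> x = 0}"
  have U0: "subspace U0" "U0 \<subseteq> U"
    unfolding U0_def using sub by (auto intro: subspace_inter subspace_hyperplane)
  have U0dim: "dim U0 \<le> m"
  proof -
    have "dim U0 \<noteq> dim U"
    proof
      assume "dim U0 = dim U"
      then have "U0 = U" using U0 sub by (intro subspace_dim_equal) auto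
      then have "e \<in> U0" using e by simp
      then show False using ge by (simp add: U0_def)
    qed
    moreover have "dim U0 \<le> dim U" using U0 by (intro dim_subset)
    ultimately show ?thesis using U by simp
  qed
  have prjU: "prj e g x \<in> U0" if "x \<in> U" for x
    using that e sub ge by (auto simp: U0_def prj_def inner_diff_right subspace_diff subspace_scale)
  \<comment> \<open>Integrality of g on the lattice is what makes shadows lattice polytopes.\<close>
  have prjG: "prj e g x \<in> ?G" if "x \<in> ?G" for x
    using that e gZ[OF that] prjU U0(2) by (auto simp: prj_def intro!: zlat_diff zlat_scale)
  \<comment> \<open>Coincidences between shadows of different pairs V, b do no harm: duality only
    compares shadows that differ as polytopes.\<close>
  define B where "B = {shadow e g (raise e g b) | V b. ratsub V \<and> dim V = m \<and> V \<subseteq> U \<and> e \<notin> V \<and> V \<noteq> U0 \<and> b \<in> BB V}"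
  have shadowG: "ipoly_in ?G (shadow e g (raise e g P))" if "ipoly_in ?G P" for P
    using that ge by (intro ipoly_in_shadow[of ?G] ipoly_in_raise[of ?G] G_shift prjG)
      (auto intro: raise_nonneg)
  have zG: "ipoly_in zlat P" if "ipoly_in ?G P" for P :: "(real^'n) set"
    using that by (rule ipoly_in_mono) auto
  have BBG: "ipoly_in ?G b" "ipoly_in (V \<inter> zlat) b" "par b V" if "ratsub V" "dim V = m" "V \<subseteq> U" "b \<in> BB V" for V b
  proof -
    show 1: "ipoly_in (V \<inter> zlat) b" using IH that by (auto simp: local_basis_def)
    show "ipoly_in ?G b" using 1 by (rule ipoly_in_mono) (use that in auto)
    show "par b V" using 1 that by (intro par_ipoly_in[of V "V \<inter> zlat"]) (auto simp: ratsub_def)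
  qed
  have dual: "\<exists>c. dimfun U c \<and> c X = 1 \<and> (\<forall>Y\<in>B. Y \<noteq> X \<longrightarrow> c Y = 0)" if "X \<in> B" for X
  proof -
    obtain V b where X: "X = shadow e g (raise e g b)"
      and V: "ratsub V" "dim V = m" "V \<subseteq> U" "e \<notin> V" "V \<noteq> U0" and b: "b \<in> BB V"
      using \<open>X \<in> B\<close> by (auto simp: B_def)
    have Vs: "subspace V" using V by (simp add: ratsub_def)
    obtain c where c: "dimfun V c" "c b = 1" "\<forall>b'\<in>BB V. b' \<noteq> b \<longrightarrow> c b' = 0"
      using IH[OF V(1,2)] b by (auto simp: local_basis_def)
    obtain u where u: "\<And>x. x \<in> V \<Longrightarrow> u \<bullet> x = 0" "\<And>x. x \<in> U \<Longrightarrow> u \<bullet> x = 0 \<Longrightarrow> x \<in> V" "u \<bullet> e > 0"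
      using facet_normal[OF sub Vs V(3) _ _ V(4)] e U V by auto
    let ?c = "facet_diff c u w"
    have "dimfun U ?c"
      using U V by (intro dimfun_facet_diff[OF sub Vs _ w(2) u(1,2) c(1)]) auto
    moreover have val: "?c (shadow e g (raise e g b')) = (if V' = V then c b' else 0)"
      if V': "ratsub V'" "dim V' = m" "V' \<subseteq> U" and b': "b' \<in> BB V'" for V' b'
    proof -
      note G = BBG[OF V' b']
      let ?v = "of_int \<lceil>supp b' (- g)\<rceil> *\<^sub>R e"
      have v: "?v \<in> zlat" using e by (simp add: zlat_scale)
      have R: "ipoly_in ?G (raise e g b')" using G(1) by (rule ipoly_in_raise) (rule G_shift)
      have RU: "x \<in> U" if "x \<in> raise e g b'" for x
      proof -
        obtain S where "S \<subseteq> ?G" "raise e g b' = convex hull S" using R by (rule ipoly_inE)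
        then have "raise e g b' \<subseteq> U" using sub by (simp add: hull_minimal subspace_imp_convex)
        then show ?thesis using that by blast
      qed
      \<comment> \<open>The facet difference reads off the polytope whose shadow was taken; the
        translation made by \<open>raise\<close> is invisible to c.\<close>
      have "?c (shadow e g (raise e g b')) = (if V' = V then c (raise e g b') else 0)"
      proof (rule facet_diff_shadow[OF sub Vs _ V'(3) _ w(1) u(1,3) c(1) e zG[OF R] _ _ U0(1) _ _ _ zG[OF shadowG[OF G(1)]]])
        show "subspace V'" using V' by (simp add: ratsub_def)
        show "par (raise e g b') V'" unfolding raise_def par_translate by (rule G(3))
        show "0 \<le> g \<bullet> x" if "x \<in> raise e g b'" for x using G(1) ge that by (rule raise_nonneg)
        show "par (prj e g ` raise e g b') U0"
          unfolding par_def using prjU RU U0(1) by (auto intro: subspace_diff)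
      qed (use V V' U0dim in auto)
      moreover have "c (raise e g b') = c b'"
        unfolding raise_def using V(2) U(3) by (intro dimfun_translate[OF c(1) zG[OF G(1)] v]) simp
      ultimately show ?thesis by simp
    qed
    have "?c X = 1" unfolding X using val[OF V(1-3) b] c(2) by simp
    moreover have "?c Y = 0" if Y: "Y \<in> B" "Y \<noteq> X" for Y
    proof -
      obtain V' b' where Y': "Y = shadow e g (raise e g b')"
        and V': "ratsub V'" "dim V' = m" "V' \<subseteq> U" "b' \<in> BB V'" using Y(1) by (auto simp: B_def)
      have "V' = V \<Longrightarrow> c b' = 0" using c(3) V' Y(2) by (auto simp: X Y')
      then show ?thesis unfolding Y' using val[OF V'] by simp
    qed
    ultimately show ?thesis by blast
  qed
  have B_poly: "ipoly_in ?G X \<and> aff_dim X = int (dim U)" if "X \<in> B" for X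
  proof -
    have X: "ipoly_in ?G X" using that BBG shadowG by (auto simp: B_def)
    have "par X U" using sub X by (intro par_ipoly_in[of U ?G]) auto
    then have le: "aff_dim X \<le> int (dim U)" using sub by (intro aff_dim_par_le)
    \<comment> \<open>Full dimension follows from duality: c would vanish on a polytope of smaller
      dimension, but it is 1 on X.\<close>
    obtain c where "dimfun U c" "c X = 1" using dual[OF \<open>X \<in> B\<close>] by blast
    then have "\<not> aff_dim X < int (dim U)" using dimfun_low[of U c X] zG[OF X] by auto
    then show ?thesis using X le by simp
  qed
  define W where "W = zm.span (lowsupp ?G (dim U) \<union> supp ` B)"
  have Wsub: "zm.subspace W" unfolding W_def by (rule zm.subspace_span)
  have Wlow: "supp P \<in> W" if "ipoly_in ?G P" "aff_dim P \<le> int m" for P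
    unfolding W_def using that U(2) by (intro zm.span_base) (auto simp: lowsupp_def)
  have Wlin: "lin v \<in> W" if "v \<in> ?G" for v
    using Wlow[of "{v}"] that by (simp add: supp_sing ipoly_in_sing)
  \<comment> \<open>The segment counts as low-dimensional because m is at least 1.\<close>
  have Wseg: "supp (convex hull {0, - e}) \<in> W"
    by (rule Wlow) (use e sub U(3) \<open>e \<noteq> 0\<close> in \<open>auto intro!: ipoly_in_hull simp: aff_dim_convex_hull zlat_minus subspace_neg subspace_0\<close>)
  have Wflat: "rho e g (supp P) \<in> W" if "ipoly_in ?G P" "aff_dim P \<le> int m" "\<And>y. y \<in> P \<Longrightarrow> g \<bullet> y = of_int k" for P k
    using rho_supp_flat[OF that(1), of g k e] that Wseg Wlow[OF that(1,2)]
    by (metis Wsub zm.subspace_add zm.subspace_scale)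
  have Wrho_lin: "rho e g (lin v) \<in> W" if "v \<in> ?G" for v
  proof -
    obtain k where "g \<bullet> v = of_int k" using gZ[OF \<open>v \<in> ?G\<close>] by (auto elim: Ints_cases)
    then show ?thesis using Wflat[of "{v}" k] \<open>v \<in> ?G\<close> by (simp add: supp_sing ipoly_in_sing)
  qed
  \<comment> \<open>\<open>rho\<close> corresponds to a shadow only after raising, which changes it
    by \<open>rho\<close> of a lattice point; such a point has constant height.\<close>
  have Wraise: "rho e g (supp P) \<in> W" if P: "ipoly_in ?G P" and S: "supp (shadow e g (raise e g P)) \<in> W" for P
  proof -
    let ?v = "of_int \<lceil>supp P (- g)\<rceil> *\<^sub>R e"
    have v: "?v \<in> ?G" using G_shift[of 0] sub by (simp add: subspace_0)
    have "supp (shadow e g (raise e g P)) = rho e g (supp (raise e g P))"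
      using ipoly_in_raise[OF P G_shift] raise_nonneg[OF P ge] by (rule supp_shadow)
    also have "\<dots> = rho e g (supp P) + rho e g (lin ?v)" by (simp only: supp_raise[OF P] rho_add)
    finally have "rho e g (supp P) = supp (shadow e g (raise e g P)) - rho e g (lin ?v)" by (simp only: add_diff_cancel)
    then show ?thesis using S Wrho_lin[OF v] Wsub by (metis zm.subspace_diff)
  qed
  have Wdim: "rho e g (supp P) \<in> W" if P: "ipoly_in ?G P" and dim: "aff_dim P < int m" for P
  proof (rule Wraise[OF P])
    have "aff_dim (shadow e g (raise e g P)) \<le> aff_dim P + 1"
      using aff_dim_shadow_le[of e g "raise e g P"] by (simp add: raise_def aff_dim_translate)
    then show "supp (shadow e g (raise e g P)) \<in> W" using dim by (intro Wlow shadowG P) auto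
  qed
  have Wfacet: "rho e g (supp P) \<in> W" if P: "ipoly_in ?G P" and dim: "aff_dim P \<le> int m" for P
  proof (cases "aff_dim P < int m")
    case True
    then show ?thesis using P by (rule Wdim[rotated])
  next
    case False
    define D where "D = dirspace P"
    obtain a where a: "a \<in> ?G" "a \<in> P" and Q: "ipoly_in (D \<inter> zlat) ((\<lambda>x. x + (- a)) ` P)"
      "supp P = supp ((\<lambda>x. x + (- a)) ` P) + lin a" and D: "ratsub D"
      using ipoly_in_dirspace[OF P] unfolding D_def by blast
    have Ds: "subspace D" using D by (simp add: ratsub_def)
    have PU: "par P U" using sub P by (intro par_ipoly_in[of U ?G]) auto
    have DU: "D \<subseteq> U" unfolding D_def using sub PU by (rule dirspace_minimal)
    have Ddim: "dim D = m"
      using dim False dim_dirspace[OF ipoly_in_nonempty[OF P]] by (simp add: D_def)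
    have PD: "par P D" unfolding D_def by (rule par_dirspace)
    \<comment> \<open>If e lies in D, the shadow stays parallel to D. If D is U0, the height on P is
      constant. Otherwise the shadows of the local basis of D belong to B by definition.\<close>
    consider "e \<in> D" | "D = U0" | "e \<notin> D" "D \<noteq> U0" by blast
    then show ?thesis
    proof cases
      case 1
      have "par (shadow e g (raise e g P)) D"
        using Ds 1 PD by (intro par_shadow) (auto simp: raise_def par_translate)
      then have "aff_dim (shadow e g (raise e g P)) \<le> int (dim D)" using Ds by (intro aff_dim_par_le)
      then show ?thesis using P Ddim by (intro Wraise Wlow shadowG) auto
    next
      case 2
      obtain k where k: "g \<bullet> a = of_int k" using gZ[OF a(1)] by (auto elim: Ints_cases)
      have "g \<bullet> y = of_int k" if "y \<in> P" for y
      proof -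
        have "y - a \<in> U0" using PD that a(2) 2 by (auto simp: par_def)
        then show ?thesis using k by (simp add: U0_def inner_diff_right)
      qed
      then show ?thesis using P dim by (intro Wflat)
    next
      case 3
      let ?Q = "(\<lambda>x. x + (- a)) ` P"
      have "supp ?Q \<in> zm.span (lowsupp (D \<inter> zlat) m \<union> supp ` BB D)"
        using IH[OF D Ddim] Q(1) Ddim by (auto simp: local_basis_def)
      \<comment> \<open>As \<open>rho\<close> is additive, only generators matter: those of lower
        dimension fall under \<open>Wdim\<close>, basis polytopes under their shadows.\<close>
      then have rQ: "rho e g (supp ?Q) \<in> W"
      proof (rule rho_span[OF _ Wsub])
        fix f assume "f \<in> lowsupp (D \<inter> zlat) m \<union> supp ` BB D"
        then consider R where "f = supp R" "ipoly_in (D \<inter> zlat) R" "aff_dim R < int m"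
          | b where "f = supp b" "b \<in> BB D" by (auto simp: lowsupp_def)
        then show "rho e g f \<in> W"
        proof cases
          case 1
          then show ?thesis using DU by (auto intro!: Wdim intro: ipoly_in_mono)
        next
          case (2 b)
          have "shadow e g (raise e g b) \<in> B" using 2 3 D Ddim DU by (auto simp: B_def)
          then have "supp (shadow e g (raise e g b)) \<in> W" unfolding W_def by (intro zm.span_base) auto
          then show ?thesis unfolding 2(1) using BBG(1)[OF D Ddim DU 2(2)] by (intro Wraise)
        qed
      qed
      have "rho e g (supp P) = rho e g (supp ?Q) + rho e g (lin a)" by (metis rho_add Q(2))
      then show ?thesis using rQ Wrho_lin[OF a(1)] Wsub by (metis zm.subspace_add)
    qed
  qed
  have prj_ipoly: "ipoly_in ?G (prj e g ` P)" "aff_dim (prj e g ` P) \<le> int m" if P: "ipoly_in ?G P" for P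
  proof -
    obtain S where S: "finite S" "S \<noteq> {}" "S \<subseteq> ?G" "P = convex hull S" using P by (rule ipoly_inE)
    have "prj e g ` P = convex hull (prj e g ` S)"
      unfolding S(4) using convex_hull_linear_image[OF linear_prj] by metis
    moreover have "prj e g ` S \<subseteq> U0 \<inter> zlat" using S(3) prjU prjG by blast
    ultimately have P0: "ipoly_in (U0 \<inter> zlat) (prj e g ` P)" using S ipoly_in_hull[of "prj e g ` S"] by simp
    then show "ipoly_in ?G (prj e g ` P)" by (rule ipoly_in_mono) (use U0 in auto)
    have "par (prj e g ` P) U0" using U0 P0 by (intro par_ipoly_in[of U0 "U0 \<inter> zlat"]) auto
    then have "aff_dim (prj e g ` P) \<le> int (dim U0)" using U0 by (intro aff_dim_par_le)
    then show "aff_dim (prj e g ` P) \<le> int m" using U0dim by simp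
  qed
  \<comment> \<open>m + 1 points span dimension at most m, while m + 2 points have coinciding or
    affinely dependent projections in U0. This fixes the threshold \<open>Suc m\<close>.\<close>
  have small: "ipoly_in ?G (convex hull A)" "aff_dim (convex hull A) \<le> int m"
    if "finite S" "S \<subseteq> ?G" "A \<subseteq> S" "A \<noteq> {}" "card A \<le> Suc m" for A S
  proof -
    have "finite A" using that finite_subset by blast
    then show "ipoly_in ?G (convex hull A)" using that by (intro ipoly_in_hull) auto
    show "aff_dim (convex hull A) \<le> int m"
      using aff_dim_le_card[OF \<open>finite A\<close>] that(5) by (simp add: aff_dim_convex_hull)
  qed
  have all: "supp P \<in> W" if P: "ipoly_in ?G P" for P
  proof -
    obtain S where S: "finite S" "S \<noteq> {}" "S \<subseteq> ?G" "P = convex hull S" using P by (rule ipoly_inE)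
    have prjS: "prj e g ` S \<subseteq> U0" using S(3) prjU by blast
    have "rho e g (supp (convex hull S)) \<in> W"
      by (rule rho_radon_reduce[OF ge S(1,2) prjS U0(1) _ Wsub, of "Suc m"])
        (use U0dim small[OF S(1,3)] Wfacet in auto)
    moreover have "rho (- e) (- g) (supp (convex hull S)) \<in> W"
    proof (rule rho_radon_reduce[OF _ S(1,2) _ U0(1) _ Wsub, of "- g" "- e" "Suc m"])
      fix A assume A: "A \<subseteq> S" "A \<noteq> {}" "card A \<le> Suc m"
      note sm = small[OF S(1,3) A]
      \<comment> \<open>For few points the opposite tilt is expressed by the first one and terms of
        low dimension, so no second family of shadows has to enter B.\<close>
      have "rho (- e) (- g) (supp (convex hull A)) =
        supp (convex hull A) - rho e g (supp (convex hull A)) + supp (prj e g ` (convex hull A))"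
        using supp_split[OF sm(1), of e g] by (simp add: fun_eq_iff algebra_simps)
      then show "rho (- e) (- g) (supp (convex hull A)) \<in> W"
        using Wlow[OF sm] Wfacet[OF sm] Wlow[OF prj_ipoly[OF sm(1)]] Wsub
        by (metis zm.subspace_add zm.subspace_diff)
    qed (use ge prjS U0dim in \<open>auto simp: prj_minus\<close>)
    ultimately show ?thesis
      using supp_split[OF P, of e g] Wlow[OF prj_ipoly[OF P]] Wsub S(4)
      by (metis zm.subspace_add zm.subspace_diff)
  qed
  have "local_basis U B"
    unfolding local_basis_def using B_poly dual all by (auto simp: W_def)
  then show ?thesis by blast
qed

theorem local_basis_exists:
  fixes U :: "(real^'n::finite) set"
  assumes "ratsub U" "dim U \<ge> 1"
  shows "\<exists>B. local_basis U B"
proof -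
  have "\<forall>U :: (real^'n) set. ratsub U \<and> dim U = Suc m \<longrightarrow> (\<exists>B. local_basis U B)" for m
  proof (induction m)
    case 0
    then show ?case using local_basis_1 by auto
  next
    case (Suc m)
    then obtain BB where "\<And>V :: (real^'n) set. ratsub V \<Longrightarrow> dim V = Suc m \<Longrightarrow> local_basis V (BB V)" by metis
    then show ?case using local_basis_step[of _ "Suc m" BB] by auto
  qed
  then show ?thesis using assms by (cases "dim U") auto
qed

subsection \<open>Abelian groups modelled by functions modulo a subgroup\<close>

text \<open>Independence of residues modulo L, indexed by B: distinct elements with congruent values
  already count as dependent.\<close>

definition indep_mod :: "('x \<Rightarrow> real) set \<Rightarrow> ('a \<Rightarrow> 'x \<Rightarrow> real) \<Rightarrow> 'a set \<Rightarrow> bool" where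
  "indep_mod L \<theta> B \<longleftrightarrow>
     (\<forall>F c. finite F \<longrightarrow> F \<subseteq> B \<longrightarrow> (\<Sum>b\<in>F. int_scale (c b) (\<theta> b)) \<in> L \<longrightarrow> (\<forall>b\<in>F. c b = 0))"

lemma indep_modD:
  "indep_mod L \<theta> B \<Longrightarrow> finite F \<Longrightarrow> F \<subseteq> B \<Longrightarrow> (\<Sum>b\<in>F. int_scale (c b) (\<theta> b)) \<in> L \<Longrightarrow> b \<in> F \<Longrightarrow> c b = 0"
  unfolding indep_mod_def by blast

lemma indep_mod_mono: "indep_mod L \<theta> B \<Longrightarrow> A \<subseteq> B \<Longrightarrow> indep_mod L \<theta> A"
  unfolding indep_mod_def by blast

text \<open>Coefficients are carried along f, and the corrections disappear in L. It serves to pass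
  from polytopes to classes and from classes to lifts.\<close>

lemma indep_mod_image:
  assumes L: "zm.subspace L" and ind: "indep_mod L \<theta> B" and f: "inj_on f A" "f ` A \<subseteq> B"
    and \<theta>: "\<And>a. a \<in> A \<Longrightarrow> \<theta>' a - \<theta> (f a) \<in> L"
  shows "indep_mod L \<theta>' A"
  unfolding indep_mod_def
proof (intro allI impI ballI)
  fix F c a assume F: "finite F" "F \<subseteq> A" and rel: "(\<Sum>a\<in>F. int_scale (c a) (\<theta>' a)) \<in> L" and a: "a \<in> F"
  have inj: "inj_on f F" using f(1) F(2) by (rule inj_on_subset)
  define d where "d b = c (inv_into F f b)" for b
  have d: "d (f x) = c x" if "x \<in> F" for x using that inj by (simp add: d_def)
  have "(\<Sum>x\<in>F. int_scale (c x) (\<theta>' x - \<theta> (f x))) \<in> L"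
    using F(2) \<theta> by (intro zm.subspace_sum zm.subspace_scale L) auto
  then have "(\<Sum>x\<in>F. int_scale (c x) (\<theta>' x)) - (\<Sum>x\<in>F. int_scale (c x) (\<theta>' x - \<theta> (f x))) \<in> L"
    by (rule zm.subspace_diff[OF L rel])
  also have "(\<Sum>x\<in>F. int_scale (c x) (\<theta>' x)) - (\<Sum>x\<in>F. int_scale (c x) (\<theta>' x - \<theta> (f x)))
      = (\<Sum>x\<in>F. int_scale (c x) (\<theta> (f x)))"
    by (simp add: zm.scale_right_diff_distrib sum_subtractf)
  also have "\<dots> = (\<Sum>b\<in>f ` F. int_scale (d b) (\<theta> b))" by (simp add: sum.reindex[OF inj] d)
  finally have "d (f a) = 0"
    using F f(2) a by (intro indep_modD[OF ind, of "f ` F" d]) auto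
  then show "c a = 0" using d a by simp
qed

lemma span_mod_coeffs:
  assumes L: "zm.subspace L" and x: "x \<in> zm.span (L \<union> \<theta> ` B)"
  shows "\<exists>F c. finite F \<and> F \<subseteq> B \<and> x - (\<Sum>b\<in>F. int_scale (c b) (\<theta> b)) \<in> L"
  using x
proof (induction rule: zm.span_induct_alt)
  case base
  show ?case by (intro exI[of _ "{}"]) (use zm.subspace_0[OF L] in \<open>simp add: zero_fun_def\<close>)
next
  case (step k y z)
  then obtain F c where F: "finite F" "F \<subseteq> B" "z - (\<Sum>b\<in>F. int_scale (c b) (\<theta> b)) \<in> L" by blast
  from step(1) consider "y \<in> L" | b where "b \<in> B" "y = \<theta> b" by blast
  then show ?case
  proof cases
    case 1
    have "int_scale k y + (z - (\<Sum>b\<in>F. int_scale (c b) (\<theta> b))) \<in> L"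
      by (intro zm.subspace_add zm.subspace_scale L 1 F)
    then show ?thesis using F(1,2) by (intro exI[of _ F] exI[of _ c]) (simp only: add_diff_eq simp_thms)
  next
    case (2 b)
    \<comment> \<open>b may already occur in F, so k is added to its coefficient.\<close>
    define d where "d = (\<lambda>x. (if x \<in> F then c x else 0) + (if x = b then k else 0))"
    have "(\<Sum>x\<in>insert b F. int_scale (d x) (\<theta> x)) =
        (\<Sum>x\<in>insert b F. int_scale (if x \<in> F then c x else 0) (\<theta> x)) + (\<Sum>x\<in>insert b F. int_scale (if x = b then k else 0) (\<theta> x))"
      by (simp only: d_def zm.scale_left_distrib sum.distrib)
    also have "(\<Sum>x\<in>insert b F. int_scale (if x \<in> F then c x else 0) (\<theta> x)) = (\<Sum>x\<in>F. int_scale (c x) (\<theta> x))"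
      using F(1) by (intro sum.mono_neutral_cong_right) auto
    also have "(\<Sum>x\<in>insert b F. int_scale (if x = b then k else 0) (\<theta> x)) = (\<Sum>x\<in>{b}. int_scale k (\<theta> x))"
      using F(1) by (intro sum.mono_neutral_cong_right) auto
    also have "(\<Sum>x\<in>{b}. int_scale k (\<theta> x)) = int_scale k y" using 2(2) by simp
    finally have sum: "(\<Sum>x\<in>insert b F. int_scale (d x) (\<theta> x)) = (\<Sum>x\<in>F. int_scale (c x) (\<theta> x)) + int_scale k y" .
    have "int_scale k y + z - (\<Sum>x\<in>insert b F. int_scale (d x) (\<theta> x)) = z - (\<Sum>b\<in>F. int_scale (c b) (\<theta> b))"
      unfolding sum by (simp add: algebra_simps)
    then have "int_scale k y + z - (\<Sum>x\<in>insert b F. int_scale (d x) (\<theta> x)) \<in> L" by (simp only: F(3))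
    moreover have "finite (insert b F)" "insert b F \<subseteq> B" using F 2(1) by auto
    ultimately show ?thesis by blast
  qed
qed

text \<open>\<open>\<theta>\<close> is additive only modulo L because a class is evaluated at a
  representative picked by \<open>SOME\<close>. Being injective modulo L, it pulls back all group
  laws, so that P, P_T and the lattice are treated alike.\<close>

locale additive_model =
  fixes G :: "('a, 'b) monoid_scheme" (structure)
    and \<theta> :: "'a \<Rightarrow> 'x \<Rightarrow> real" and L :: "('x \<Rightarrow> real) set"
  assumes L: "zm.subspace L"
    and mult_closed: "x \<in> carrier G \<Longrightarrow> y \<in> carrier G \<Longrightarrow> x \<otimes> y \<in> carrier G"
    and unit_closed: "\<one> \<in> carrier G"
    and model_mult: "x \<in> carrier G \<Longrightarrow> y \<in> carrier G \<Longrightarrow> \<theta> (x \<otimes> y) - (\<theta> x + \<theta> y) \<in> L"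
    and model_one: "\<theta> \<one> \<in> L"
    and model_eqI: "x \<in> carrier G \<Longrightarrow> y \<in> carrier G \<Longrightarrow> \<theta> x - \<theta> y \<in> L \<Longrightarrow> x = y"
    and model_inverse: "x \<in> carrier G \<Longrightarrow> \<exists>y\<in>carrier G. \<theta> x + \<theta> y \<in> L"
begin

lemma L_add: "x \<in> L \<Longrightarrow> y \<in> L \<Longrightarrow> x + y \<in> L"
  and L_diff: "x \<in> L \<Longrightarrow> y \<in> L \<Longrightarrow> x - y \<in> L"
  using L by (auto intro: zm.subspace_add zm.subspace_diff)

lemma is_comm_group: "comm_group G"
proof (rule comm_groupI)
  fix x y z assume x: "x \<in> carrier G" and y: "y \<in> carrier G" and z: "z \<in> carrier G"
  show "x \<otimes> y \<in> carrier G" using x y by (rule mult_closed)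
  show "x \<otimes> y \<otimes> z = x \<otimes> (y \<otimes> z)"
  proof (rule model_eqI)
    have "\<theta> (x \<otimes> y \<otimes> z) - \<theta> (x \<otimes> (y \<otimes> z)) =
      ((\<theta> (x \<otimes> y \<otimes> z) - (\<theta> (x \<otimes> y) + \<theta> z)) + (\<theta> (x \<otimes> y) - (\<theta> x + \<theta> y))) -
      ((\<theta> (x \<otimes> (y \<otimes> z)) - (\<theta> x + \<theta> (y \<otimes> z))) + (\<theta> (y \<otimes> z) - (\<theta> y + \<theta> z)))" by (simp add: algebra_simps)
    also have "\<dots> \<in> L" using x y z by (intro L_diff L_add model_mult mult_closed)
    finally show "\<theta> (x \<otimes> y \<otimes> z) - \<theta> (x \<otimes> (y \<otimes> z)) \<in> L" .
  qed (use x y z in \<open>auto intro: mult_closed\<close>)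
  show "x \<otimes> y = y \<otimes> x"
  proof (rule model_eqI)
    have "\<theta> (x \<otimes> y) - \<theta> (y \<otimes> x) = (\<theta> (x \<otimes> y) - (\<theta> x + \<theta> y)) - (\<theta> (y \<otimes> x) - (\<theta> y + \<theta> x))"
      by (simp add: algebra_simps)
    also have "\<dots> \<in> L" using x y by (intro L_diff model_mult)
    finally show "\<theta> (x \<otimes> y) - \<theta> (y \<otimes> x) \<in> L" .
  qed (use x y in \<open>auto intro: mult_closed\<close>)
next
  fix x assume x: "x \<in> carrier G"
  show "\<one> \<otimes> x = x"
  proof (rule model_eqI)
    have "\<theta> (\<one> \<otimes> x) - \<theta> x = (\<theta> (\<one> \<otimes> x) - (\<theta> \<one> + \<theta> x)) + \<theta> \<one>" by (simp add: algebra_simps)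
    also have "\<dots> \<in> L" using x by (intro L_add model_mult model_one unit_closed)
    finally show "\<theta> (\<one> \<otimes> x) - \<theta> x \<in> L" .
  qed (use x in \<open>auto intro: mult_closed unit_closed\<close>)
  obtain y where y: "y \<in> carrier G" "\<theta> x + \<theta> y \<in> L" using model_inverse[OF x] by blast
  have "y \<otimes> x = \<one>"
  proof (rule model_eqI)
    have "\<theta> (y \<otimes> x) - \<theta> \<one> = (\<theta> (y \<otimes> x) - (\<theta> y + \<theta> x)) + (\<theta> x + \<theta> y) - \<theta> \<one>" by (simp add: algebra_simps)
    also have "\<dots> \<in> L" by (rule L_diff[OF L_add[OF model_mult[OF y(1) x] y(2)] model_one])
    finally show "\<theta> (y \<otimes> x) - \<theta> \<one> \<in> L" .
  qed (use x y in \<open>auto intro: mult_closed unit_closed\<close>)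
  then show "\<exists>y\<in>carrier G. y \<otimes> x = \<one>" using y by blast
qed (rule unit_closed)

sublocale comm_group G
  by (rule is_comm_group)

lemma model_inv:
  assumes "x \<in> carrier G"
  shows "\<theta> (inv x) + \<theta> x \<in> L"
proof -
  have "\<theta> (inv x \<otimes> x) - (\<theta> (inv x \<otimes> x) - (\<theta> (inv x) + \<theta> x)) \<in> L"
    using assms model_one by (intro L_diff model_mult) auto
  then show ?thesis by simp
qed

lemma model_pow_nat:
  assumes "x \<in> carrier G"
  shows "\<theta> (x [^] (n::nat)) - int_scale (int n) (\<theta> x) \<in> L"
proof (induction n)
  case 0
  then show ?case using model_one by (simp add: zm.scale_zero_left)
next
  case (Suc n)
  have "\<theta> (x [^] Suc n) - int_scale (int (Suc n)) (\<theta> x) =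
    (\<theta> (x [^] n \<otimes> x) - (\<theta> (x [^] n) + \<theta> x)) + (\<theta> (x [^] n) - int_scale (int n) (\<theta> x))"
    by (simp add: zm.scale_left_distrib)
  also have "\<dots> \<in> L" by (rule L_add[OF model_mult[OF nat_pow_closed[OF assms] assms] Suc])
  finally show ?case .
qed

lemma model_pow:
  assumes "x \<in> carrier G"
  shows "\<theta> (x [^] (k::int)) - int_scale k (\<theta> x) \<in> L"
proof (cases "k \<ge> 0")
  case True
  then have "x [^] k = x [^] nat k" by (subst int_pow_def2) simp
  then show ?thesis using model_pow_nat[OF assms, of "nat k"] True by (simp only: int_nat_eq if_True)
next
  case False
  let ?y = "x [^] nat (- k)"
  have "\<theta> (inv ?y) - int_scale k (\<theta> x) = (\<theta> (inv ?y) + \<theta> ?y) - (\<theta> ?y - int_scale (int (nat (- k))) (\<theta> x))"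
    using False by (simp add: fun_eq_iff)
  also have "\<dots> \<in> L" by (rule L_diff[OF model_inv[OF nat_pow_closed[OF assms]] model_pow_nat[OF assms]])
  finally have "\<theta> (inv ?y) - int_scale k (\<theta> x) \<in> L" .
  moreover have "x [^] k = inv ?y" using False by (subst int_pow_def2) simp
  ultimately show ?thesis by simp
qed

lemma model_finprod:
  assumes "finite F" "f \<in> F \<rightarrow> carrier G"
  shows "\<theta> (finprod G f F) - (\<Sum>i\<in>F. \<theta> (f i)) \<in> L"
  using assms
proof (induction F rule: finite_induct)
  case empty
  then show ?case using model_one by simp
next
  case (insert i F)
  have "\<theta> (finprod G f (insert i F)) - (\<Sum>i\<in>insert i F. \<theta> (f i)) =
    (\<theta> (f i \<otimes> finprod G f F) - (\<theta> (f i) + \<theta> (finprod G f F))) + (\<theta> (finprod G f F) - (\<Sum>i\<in>F. \<theta> (f i)))"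
    using insert by (simp add: Pi_iff algebra_simps)
  also have "\<dots> \<in> L"
  proof (rule L_add)
    show "\<theta> (f i \<otimes> finprod G f F) - (\<theta> (f i) + \<theta> (finprod G f F)) \<in> L"
      using insert.prems by (intro model_mult finprod_closed) auto
    show "\<theta> (finprod G f F) - (\<Sum>i\<in>F. \<theta> (f i)) \<in> L" using insert.prems by (intro insert.IH) auto
  qed
  finally show ?case .
qed

lemma model_comb:
  assumes "finite F" "F \<subseteq> carrier G"
  shows "\<theta> (finprod G (\<lambda>b. b [^] (c b :: int)) F) - (\<Sum>b\<in>F. int_scale (c b) (\<theta> b)) \<in> L"
proof -
  have "\<theta> (finprod G (\<lambda>b. b [^] c b) F) - (\<Sum>b\<in>F. int_scale (c b) (\<theta> b)) =
    (\<theta> (finprod G (\<lambda>b. b [^] c b) F) - (\<Sum>b\<in>F. \<theta> (b [^] c b))) + (\<Sum>b\<in>F. \<theta> (b [^] c b) - int_scale (c b) (\<theta> b))"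
    by (simp add: sum_subtractf)
  also have "\<dots> \<in> L"
  proof (rule L_add)
    show "\<theta> (finprod G (\<lambda>b. b [^] c b) F) - (\<Sum>b\<in>F. \<theta> (b [^] c b)) \<in> L"
      using assms by (intro model_finprod) auto
    show "(\<Sum>b\<in>F. \<theta> (b [^] c b) - int_scale (c b) (\<theta> b)) \<in> L"
      using assms by (intro zm.subspace_sum[OF L] model_pow) auto
  qed
  finally show ?thesis .
qed

lemma eq_comb_iff:
  assumes "finite F" "F \<subseteq> carrier G" "x \<in> carrier G"
  shows "x = finprod G (\<lambda>b. b [^] (c b :: int)) F \<longleftrightarrow> \<theta> x - (\<Sum>b\<in>F. int_scale (c b) (\<theta> b)) \<in> L"
proof
  assume "x = finprod G (\<lambda>b. b [^] c b) F"
  then show "\<theta> x - (\<Sum>b\<in>F. int_scale (c b) (\<theta> b)) \<in> L" using model_comb assms by simp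
next
  let ?p = "finprod G (\<lambda>b. b [^] c b) F"
  assume "\<theta> x - (\<Sum>b\<in>F. int_scale (c b) (\<theta> b)) \<in> L"
  then have "(\<theta> x - (\<Sum>b\<in>F. int_scale (c b) (\<theta> b))) - (\<theta> ?p - (\<Sum>b\<in>F. int_scale (c b) (\<theta> b))) \<in> L"
    using model_comb[OF assms(1,2)] by (rule L_diff)
  then have "\<theta> x - \<theta> ?p \<in> L" by simp
  moreover have "?p \<in> carrier G" using assms by (intro finprod_closed) auto
  ultimately show "x = ?p" using assms by (intro model_eqI)
qed

lemma zbasisI:
  assumes B: "B \<subseteq> S" and S: "S \<subseteq> carrier G" and ind: "indep_mod L \<theta> B"
    and span: "\<And>x. x \<in> S \<Longrightarrow> \<theta> x \<in> zm.span (L \<union> \<theta> ` B)"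
  shows "zbasis G S B"
  unfolding zbasis_def
proof (intro conjI ballI B)
  fix x assume x: "x \<in> S"
  have xc: "x \<in> carrier G" using x S by blast
  have Bc: "B \<subseteq> carrier G" using B S by blast
  obtain F c where F: "finite F" "F \<subseteq> B" "\<theta> x - (\<Sum>b\<in>F. int_scale (c b) (\<theta> b)) \<in> L"
    using span_mod_coeffs[OF L span[OF x]] by blast
  \<comment> \<open>\<open>zbasis\<close> counts coefficient functions on the whole type, so c is
    set to 0 outside F.\<close>
  define d where "d b = (if b \<in> F then c b else 0)" for b
  let ?D = "\<lambda>d :: 'a \<Rightarrow> int. {b. d b \<noteq> 0}"
  have D: "?D d \<subseteq> F" by (auto simp: d_def)
  have sum_eq: "(\<Sum>b\<in>E. int_scale (d b) (\<theta> b)) = (\<Sum>b\<in>?D d. int_scale (d b) (\<theta> b))"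
    if "finite E" "?D d \<subseteq> E" for E and d :: "'a \<Rightarrow> int"
    using that by (intro sum.mono_neutral_right) auto
  show "\<exists>!c. (\<forall>b. b \<notin> B \<longrightarrow> c b = 0) \<and> finite (?D c) \<and> x = finprod G (\<lambda>b. b [^] c b) (?D c)"
  proof (rule ex1I)
    have "(\<Sum>b\<in>F. int_scale (c b) (\<theta> b)) = (\<Sum>b\<in>F. int_scale (d b) (\<theta> b))"
      by (intro sum.cong) (auto simp: d_def)
    then have "\<theta> x - (\<Sum>b\<in>?D d. int_scale (d b) (\<theta> b)) \<in> L" using F sum_eq[OF F(1) D] by simp
    moreover have "finite (?D d)" using F D finite_subset by blast
    moreover have "?D d \<subseteq> carrier G" using D F(2) Bc by blast
    ultimately have "x = finprod G (\<lambda>b. b [^] d b) (?D d)" using xc by (simp add: eq_comb_iff)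
    then show "(\<forall>b. b \<notin> B \<longrightarrow> d b = 0) \<and> finite (?D d) \<and> x = finprod G (\<lambda>b. b [^] d b) (?D d)"
      using F(2) \<open>finite (?D d)\<close> by (auto simp: d_def)
  next
    fix d' :: "'a \<Rightarrow> int"
    assume d': "(\<forall>b. b \<notin> B \<longrightarrow> d' b = 0) \<and> finite (?D d') \<and> x = finprod G (\<lambda>b. b [^] d' b) (?D d')"
    have D': "?D d' \<subseteq> B" using d' by blast
    then have "?D d' \<subseteq> carrier G" using Bc by blast
    then have 1: "\<theta> x - (\<Sum>b\<in>?D d'. int_scale (d' b) (\<theta> b)) \<in> L"
      using d' xc eq_comb_iff[of "?D d'" x d'] by simp
    \<comment> \<open>A common finite support for both coefficient families, on which independence
      is applied to their difference.\<close>
    define E where "E = F \<union> ?D d'"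
    have E: "finite E" "E \<subseteq> B" "?D d \<subseteq> E" "?D d' \<subseteq> E" using F d' D D' by (auto simp: E_def)
    have "(\<Sum>b\<in>F. int_scale (c b) (\<theta> b)) = (\<Sum>b\<in>F. int_scale (d b) (\<theta> b))"
      by (intro sum.cong) (auto simp: d_def)
    then have 2: "\<theta> x - (\<Sum>b\<in>?D d. int_scale (d b) (\<theta> b)) \<in> L" using F sum_eq[OF F(1) D] by simp
    have "(\<Sum>b\<in>E. int_scale (d' b - d b) (\<theta> b)) = (\<Sum>b\<in>?D d'. int_scale (d' b) (\<theta> b)) - (\<Sum>b\<in>?D d. int_scale (d b) (\<theta> b))"
      by (simp only: zm.scale_left_diff_distrib sum_subtractf sum_eq[OF E(1,3)] sum_eq[OF E(1,4)])
    also have "\<dots> = (\<theta> x - (\<Sum>b\<in>?D d. int_scale (d b) (\<theta> b))) - (\<theta> x - (\<Sum>b\<in>?D d'. int_scale (d' b) (\<theta> b)))" by simp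
    also have "\<dots> \<in> L" using 1 2 by (rule L_diff[rotated])
    finally have *: "d' b - d b = 0" if "b \<in> E" for b
      using that by (intro indep_modD[OF ind E(1,2), of "\<lambda>b. d' b - d b"])
    show "d' = d"
    proof
      fix b
      show "d' b = d b"
      proof (cases "b \<in> E")
        case True
        then show ?thesis using *[OF True] by simp
      next
        case False
        then have "d b = 0" "d' b = 0" using E(3,4) by blast+
        then show ?thesis by simp
      qed
    qed
  qed
qed

lemma zbasis_span:
  assumes "zbasis G S B" "S \<subseteq> carrier G" "x \<in> S"
  shows "\<theta> x \<in> zm.span (L \<union> \<theta> ` B)"
proof -
  have B: "B \<subseteq> carrier G" using assms by (auto simp: zbasis_def)
  obtain c :: "'a \<Rightarrow> int" where c: "\<forall>b. b \<notin> B \<longrightarrow> c b = 0" "finite {b. c b \<noteq> 0}"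
    "x = finprod G (\<lambda>b. b [^] c b) {b. c b \<noteq> 0}"
    using assms(1,3) unfolding zbasis_def by metis
  have cB: "{b. c b \<noteq> 0} \<subseteq> B" using c(1) by blast
  have "\<theta> x - (\<Sum>b\<in>{b. c b \<noteq> 0}. int_scale (c b) (\<theta> b)) \<in> L"
    using c cB B assms eq_comb_iff[of "{b. c b \<noteq> 0}" x c] by blast
  then have "(\<theta> x - (\<Sum>b\<in>{b. c b \<noteq> 0}. int_scale (c b) (\<theta> b))) + (\<Sum>b\<in>{b. c b \<noteq> 0}. int_scale (c b) (\<theta> b)) \<in> zm.span (L \<union> \<theta> ` B)"
    using cB by (intro zm.span_add zm.span_sum zm.span_scale) (auto intro: zm.span_base)
  then show ?thesis by simp
qed

text \<open>A relation modulo L is an expression of the unit; uniqueness identifies it with the one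
  whose coefficients are all 0.\<close>

lemma zbasis_indep:
  assumes "zbasis G S B" "S \<subseteq> carrier G" "\<one> \<in> S"
  shows "indep_mod L \<theta> B"
  unfolding indep_mod_def
proof (intro allI impI ballI)
  fix F c b assume F: "finite F" "F \<subseteq> B" and rel: "(\<Sum>b\<in>F. int_scale (c b) (\<theta> b)) \<in> L" and b: "b \<in> F"
  have B: "B \<subseteq> carrier G" using assms by (auto simp: zbasis_def)
  define d where "d b = (if b \<in> F then c b else 0)" for b
  let ?D = "{b. d b \<noteq> 0}"
  have D: "?D \<subseteq> F" by (auto simp: d_def)
  have "(\<Sum>b\<in>F. int_scale (c b) (\<theta> b)) = (\<Sum>b\<in>?D. int_scale (d b) (\<theta> b))"
    using F(1) D by (intro sum.mono_neutral_cong_right) (auto simp: d_def)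
  then have "\<theta> \<one> - (\<Sum>b\<in>?D. int_scale (d b) (\<theta> b)) \<in> L" using rel model_one L_diff by metis
  moreover have "finite ?D" "?D \<subseteq> carrier G" using D F B finite_subset by blast+
  ultimately have "\<one> = finprod G (\<lambda>b. b [^] d b) ?D" using eq_comb_iff[of ?D \<one> d] by blast
  moreover define P where "P c \<longleftrightarrow> (\<forall>b. b \<notin> B \<longrightarrow> c b = 0) \<and> finite {b. c b \<noteq> 0} \<and>
      \<one> = finprod G (\<lambda>b. b [^] c b) {b. c b \<noteq> 0}" for c :: "'a \<Rightarrow> int"
  ultimately have "P d" using \<open>finite ?D\<close> F(2) by (auto simp: d_def)
  moreover have "P (\<lambda>_. 0)" by (simp add: P_def)
  moreover have "\<exists>!c. P c"
    unfolding P_def by (rule bspec[OF conjunct2[OF assms(1)[unfolded zbasis_def]] assms(3)])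
  ultimately have "d = (\<lambda>_. 0)" by blast
  then show "c b = 0" using b by (metis d_def)
qed

end

subsection \<open>The polytope groups\<close>

text \<open>The common form of the two class constructions: L = {0} gives \<open>gcls\<close>, and
  \<open>lattice_lin\<close> gives \<open>tcls\<close>.\<close>

definition cls :: "(real^'n::finite \<Rightarrow> real) set \<Rightarrow> (real^'n) set \<Rightarrow> (real^'n) set \<Rightarrow> 'n pcls" where
  "cls L P Q = {(P', Q'). ipoly_in zlat P' \<and> ipoly_in zlat Q' \<and> (supp P - supp Q) - (supp P' - supp Q') \<in> L}"

text \<open>The support function of a virtual polytope. The choice of representative affects it only
  by an element of L.\<close>

definition virt :: "'n::finite pcls \<Rightarrow> real^'n \<Rightarrow> real" where
  "virt a = supp (fst (rep a)) - supp (snd (rep a))"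

lemma msum_eq_iff:
  assumes "ipoly_in zlat P" "ipoly_in zlat Q" "ipoly_in zlat P'" "ipoly_in zlat Q'"
  shows "msum P Q = msum P' Q' \<longleftrightarrow> supp P + supp Q = supp P' + supp Q'"
  using supp_inject[OF msum_ipoly_zlat[OF assms(1,2)] msum_ipoly_zlat[OF assms(3,4)]]
    supp_msum[OF assms(1,2)] supp_msum[OF assms(3,4)] by metis

lemma gcls_eq_cls:
  assumes "ipoly_in zlat P" "ipoly_in zlat Q"
  shows "gcls P Q = cls {0} P Q"
proof -
  have "msum P Q' = msum P' Q \<longleftrightarrow> (supp P - supp Q) - (supp P' - supp Q') \<in> {0}"
    if "ipoly_in zlat P'" "ipoly_in zlat Q'" for P' Q'
    using msum_eq_iff[OF assms(1) that(2,1) assms(2)] by (auto simp: algebra_simps)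
  then show ?thesis by (auto simp: gcls_def cls_def)
qed

lemma tcls_eq_cls:
  assumes "ipoly_in zlat P" "ipoly_in zlat Q"
  shows "tcls P Q = cls lattice_lin P Q"
proof -
  have "(\<exists>h\<in>zlat. msum P Q' = (\<lambda>x. x + h) ` msum P' Q) \<longleftrightarrow> (supp P - supp Q) - (supp P' - supp Q') \<in> lattice_lin"
    if P': "ipoly_in zlat P'" "ipoly_in zlat Q'" for P' Q'
  proof -
    have "msum P Q' = (\<lambda>x. x + h) ` msum P' Q \<longleftrightarrow> (supp P - supp Q) - (supp P' - supp Q') = lin h"
      if h: "h \<in> zlat" for h
    proof -
      have "msum P Q' = msum (msum P' Q) {h} \<longleftrightarrow> supp P + supp Q' = supp P' + supp Q + lin h"
        using msum_eq_iff[OF assms(1) P'(2) msum_ipoly_zlat[OF P'(1) assms(2)] ipoly_in_sing[OF h]]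
          supp_msum[OF P'(1) assms(2)] by (simp add: supp_sing)
      then show ?thesis by (auto simp: msum_sing algebra_simps)
    qed
    then show ?thesis by (auto simp: lattice_lin_def)
  qed
  then show ?thesis by (auto simp: tcls_def cls_def)
qed

lemma cls_eqI:
  assumes "zm.subspace L" "(supp P - supp Q) - (supp P' - supp Q') \<in> L"
  shows "cls L P Q = cls L P' Q'"
proof -
  have "(supp P - supp Q) - f \<in> L \<longleftrightarrow> (supp P' - supp Q') - f \<in> L" for f
    using zm.subspace_diff[OF assms(1), of "(supp P - supp Q) - f" "(supp P - supp Q) - (supp P' - supp Q')"]
      zm.subspace_add[OF assms(1), of "(supp P' - supp Q') - f" "(supp P - supp Q) - (supp P' - supp Q')"] assms(2)
    by (auto simp: algebra_simps)
  then show ?thesis by (auto simp: cls_def)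
qed

lemma rep_cls:
  assumes L: "zm.subspace L" and PQ: "ipoly_in zlat P" "ipoly_in zlat Q"
  shows "ipoly_in zlat (fst (rep (cls L P Q)))" "ipoly_in zlat (snd (rep (cls L P Q)))"
    "(supp P - supp Q) - virt (cls L P Q) \<in> L"
    "cls L (fst (rep (cls L P Q))) (snd (rep (cls L P Q))) = cls L P Q"
proof -
  have "(P, Q) \<in> cls L P Q" using PQ zm.subspace_0[OF L] by (simp add: cls_def)
  then have "rep (cls L P Q) \<in> cls L P Q" unfolding rep_def by (rule someI)
  then show *: "ipoly_in zlat (fst (rep (cls L P Q)))" "ipoly_in zlat (snd (rep (cls L P Q)))"
    "(supp P - supp Q) - virt (cls L P Q) \<in> L"
    by (auto simp: cls_def virt_def split: prod.splits)
  show "cls L (fst (rep (cls L P Q))) (snd (rep (cls L P Q))) = cls L P Q"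
    by (rule cls_eqI[OF L, symmetric]) (use *(3) in \<open>simp only: virt_def\<close>)
qed

lemma supp_0: "supp {0} = 0"
  by (simp add: supp_sing lin_0)

lemma ipoly_in_0: "ipoly_in zlat {0}"
  by (simp add: ipoly_in_sing)

lemma polytope_group_model:
  fixes Grp :: "'n::finite pcls monoid"
  assumes L: "zm.subspace L"
    and cl: "\<And>P Q. ipoly_in zlat P \<Longrightarrow> ipoly_in zlat Q \<Longrightarrow> cl P Q = cls L P Q"
    and carr: "carrier Grp = {cl P Q | P Q. ipoly_in zlat P \<and> ipoly_in zlat Q}"
    and mult: "mult Grp = (\<lambda>a b. cl (msum (fst (rep a)) (fst (rep b))) (msum (snd (rep a)) (snd (rep b))))"
    and one: "one Grp = cl {0} {0}"
  shows "additive_model Grp virt L"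
proof -
  have carrD: "ipoly_in zlat (fst (rep a))" "ipoly_in zlat (snd (rep a))"
      "a = cls L (fst (rep a)) (snd (rep a))" if "a \<in> carrier Grp" for a
    using that carr cl rep_cls[OF L] by auto
  have carrI: "cls L P Q \<in> carrier Grp" if "ipoly_in zlat P" "ipoly_in zlat Q" for P Q
    unfolding carr using that cl[OF that, symmetric] by blast
  have mult': "mult Grp a b = cls L (msum (fst (rep a)) (fst (rep b))) (msum (snd (rep a)) (snd (rep b)))"
    if "a \<in> carrier Grp" "b \<in> carrier Grp" for a b
    using carrD[OF that(1)] carrD[OF that(2)] by (simp add: mult cl msum_ipoly_zlat)
  show ?thesis
  proof (unfold_locales; (fact L)?)
    fix a b assume a: "a \<in> carrier Grp" and b: "b \<in> carrier Grp"
    note ra = carrD[OF a] and rb = carrD[OF b]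
    show "a \<otimes>\<^bsub>Grp\<^esub> b \<in> carrier Grp" unfolding mult'[OF a b]
      by (intro carrI msum_ipoly_zlat ra(1,2) rb(1,2))
    have "virt a + virt b - virt (a \<otimes>\<^bsub>Grp\<^esub> b) \<in> L"
      using rep_cls(3)[OF L msum_ipoly_zlat[OF ra(1) rb(1)] msum_ipoly_zlat[OF ra(2) rb(2)]]
      unfolding mult'[OF a b, symmetric] supp_msum[OF ra(1) rb(1)] supp_msum[OF ra(2) rb(2)]
      by (simp add: virt_def algebra_simps)
    then have "- (virt a + virt b - virt (a \<otimes>\<^bsub>Grp\<^esub> b)) \<in> L" by (rule zm.subspace_neg[OF L])
    then show "virt (a \<otimes>\<^bsub>Grp\<^esub> b) - (virt a + virt b) \<in> L" by simp
    show "a = b" if "virt a - virt b \<in> L"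
      using cls_eqI[OF L that[unfolded virt_def]] ra(3) rb(3) by metis
  next
    fix a assume a: "a \<in> carrier Grp"
    note ra = carrD[OF a]
    let ?b = "cls L (snd (rep a)) (fst (rep a))"
    have "- (supp (snd (rep a)) - supp (fst (rep a)) - virt ?b) \<in> L"
      by (rule zm.subspace_neg[OF L rep_cls(3)[OF L ra(2,1)]])
    moreover have "virt a + virt ?b = - (supp (snd (rep a)) - supp (fst (rep a)) - virt ?b)"
      by (simp add: virt_def[of a] algebra_simps)
    ultimately have "virt a + virt ?b \<in> L" by (simp only:)
    then show "\<exists>b\<in>carrier Grp. virt a + virt b \<in> L" using carrI[OF ra(2,1)] by blast
  next
    have one': "one Grp = cls L {0} {0}" by (simp add: one cl ipoly_in_0)
    show "one Grp \<in> carrier Grp" unfolding one' by (intro carrI ipoly_in_0)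
    have "- (supp {0} - supp {0} - virt (cls L {0} {0})) \<in> L"
      by (rule zm.subspace_neg[OF L rep_cls(3)[OF L ipoly_in_0 ipoly_in_0]])
    then show "virt (one Grp) \<in> L" by (simp add: one')
  qed
qed

interpretation PT: additive_model PTgrp virt lattice_lin
  by (rule polytope_group_model[OF subspace_lattice_lin tcls_eq_cls]) (simp_all add: PTgrp_def)

lemma subspace_zero: "zm.subspace {0}"
  by (rule zm.subspace_single_0)

interpretation PP: additive_model Pgrp virt "{0}"
  by (rule polytope_group_model[OF subspace_zero gcls_eq_cls]) (simp_all add: Pgrp_def)

text \<open>The lattice in the same model, so that a basis of it can be compared with the classes of
  points in \<open>Pgrp\<close>.\<close>

interpretation ZZ: additive_model Zgrp lin "{0}"
proof
  show "\<exists>y\<in>carrier Zgrp. lin x + lin y \<in> {0}" if "x \<in> carrier Zgrp" for x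
    using that by (intro bexI[of _ "- x"]) (auto simp: Zgrp_def zlat_minus lin_0 simp flip: lin_add)
  show "zm.subspace {0}" by (rule subspace_zero)
qed (auto simp: Zgrp_def zlat_add lin_add lin_0 lin_inject)

lemma virt_tcls:
  assumes "ipoly_in zlat P" "ipoly_in zlat Q"
  shows "virt (tcls P Q) - (supp P - supp Q) \<in> lattice_lin"
proof -
  have "- ((supp P - supp Q) - virt (tcls P Q)) \<in> lattice_lin"
    unfolding tcls_eq_cls[OF assms]
    by (rule zm.subspace_neg[OF subspace_lattice_lin rep_cls(3)[OF subspace_lattice_lin assms]])
  then show ?thesis by simp
qed

lemma virt_gcls:
  assumes "ipoly_in zlat P" "ipoly_in zlat Q"
  shows "virt (gcls P Q) = supp P - supp Q"
  using rep_cls(3)[OF subspace_zero assms] gcls_eq_cls[OF assms] by simp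

lemma rep_Pgrp:
  assumes "a \<in> carrier Pgrp"
  shows "ipoly_in zlat (fst (rep a))" "ipoly_in zlat (snd (rep a))"
proof -
  obtain P Q where "ipoly_in zlat P" "ipoly_in zlat Q" "a = gcls P Q" using assms by (auto simp: Pgrp_def)
  then show "ipoly_in zlat (fst (rep a))" "ipoly_in zlat (snd (rep a))"
    using rep_cls(1,2)[OF subspace_zero] gcls_eq_cls by metis+
qed

lemma tcls_in_carrier: "ipoly_in zlat P \<Longrightarrow> ipoly_in zlat Q \<Longrightarrow> tcls P Q \<in> carrier PTgrp"
  by (auto simp: PTgrp_def)

lemma proj_T:
  assumes "a \<in> carrier Pgrp"
  shows "proj_T a \<in> carrier PTgrp" "virt (proj_T a) - virt a \<in> lattice_lin"
  using virt_tcls[OF rep_Pgrp[OF assms]] tcls_in_carrier[OF rep_Pgrp[OF assms]]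
  by (simp_all add: proj_T_def virt_def[of a])

subsection \<open>Assembling the bases\<close>

text \<open>A functional takes polytopes, not functions, as arguments. Before it can be applied to
  an integer combination, this has to be realised by polytopes; a nonnegative multiple is an
  iterated Minkowski sum.\<close>

lemma dimfun_multiple:
  assumes c: "dimfun U c" "dim U \<ge> 1" and P: "ipoly_in zlat P"
  shows "\<exists>A. ipoly_in zlat A \<and> int_scale (int n) (supp P) = supp A \<and> real n * c P = c A"
proof (induction n)
  case 0
  have "c {0} = 0" using c by (intro dimfun_low[of U] ipoly_in_0) auto
  then show ?case by (intro exI[of _ "{0}"]) (simp add: ipoly_in_0 supp_0 fun_eq_iff)
next
  case (Suc n)
  then obtain A where A: "ipoly_in zlat A" "int_scale (int n) (supp P) = supp A" "real n * c P = c A" by blast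
  have "int_scale (int (Suc n)) (supp P) = int_scale (int n) (supp P) + supp P"
    by (simp add: fun_eq_iff algebra_simps)
  moreover have "real (Suc n) * c P = c (msum A P)"
    using A P by (simp add: dimfun_add[OF c(1)] algebra_simps)
  ultimately show ?case
    using A P by (intro exI[of _ "msum A P"]) (simp add: msum_ipoly_zlat supp_msum[OF A(1) P])
qed

lemma dimfun_scaled:
  assumes c: "dimfun U c" "dim U \<ge> 1" and P: "ipoly_in zlat P"
  shows "\<exists>A B. ipoly_in zlat A \<and> ipoly_in zlat B \<and> int_scale k (supp P) = supp A - supp B \<and> of_int k * c P = c A - c B"
proof -
  have c0: "c {0} = 0" using c by (intro dimfun_low[of U] ipoly_in_0) auto
  obtain A where A: "ipoly_in zlat A" "int_scale (int (nat \<bar>k\<bar>)) (supp P) = supp A" "real (nat \<bar>k\<bar>) * c P = c A"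
    using dimfun_multiple[OF assms] by blast
  show ?thesis
  proof (cases "k \<ge> 0")
    case True
    then show ?thesis using A ipoly_in_0 c0 by (intro exI[of _ A] exI[of _ "{0}"]) (simp add: supp_0)
  next
    case False
    have "int_scale k (supp P) = - int_scale (int (nat \<bar>k\<bar>)) (supp P)" using False by (simp add: fun_eq_iff)
    then have "int_scale k (supp P) = supp {0} - supp A" unfolding A(2) by (simp add: supp_0)
    moreover have "of_int k * c P = c {0} - c A" using False A(3) c0 by simp
    ultimately show ?thesis using A(1) ipoly_in_0 by blast
  qed
qed

text \<open>The combination is collected into a difference of two polytopes A and B. That it is a
  lattice functional means that A is a translate of B, and c agrees on translates.\<close>

lemma dimfun_relation:
  assumes c: "dimfun U c" "dim U \<ge> 1" and F: "finite F" "\<And>P. P \<in> F \<Longrightarrow> ipoly_in zlat P"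
    and rel: "(\<Sum>P\<in>F. int_scale (k P) (supp P)) \<in> lattice_lin"
  shows "(\<Sum>P\<in>F. of_int (k P) * c P) = 0"
proof -
  have "\<exists>A B. ipoly_in zlat A \<and> ipoly_in zlat B \<and> (\<Sum>P\<in>F. int_scale (k P) (supp P)) = supp A - supp B \<and>
      (\<Sum>P\<in>F. of_int (k P) * c P) = c A - c B"
    using F
  proof (induction F rule: finite_induct)
    case empty
    show ?case by (intro exI[of _ "{0}"]) (simp add: ipoly_in_0)
  next
    case (insert P F)
    obtain A B where AB: "ipoly_in zlat A" "ipoly_in zlat B" "(\<Sum>P\<in>F. int_scale (k P) (supp P)) = supp A - supp B"
      "(\<Sum>P\<in>F. of_int (k P) * c P) = c A - c B" using insert.IH[OF insert.prems[OF insertI2]] by blast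
    obtain C D where CD: "ipoly_in zlat C" "ipoly_in zlat D" "int_scale (k P) (supp P) = supp C - supp D"
      "of_int (k P) * c P = c C - c D" using dimfun_scaled[OF c insert.prems[OF insertI1]] by blast
    have "(\<Sum>P\<in>insert P F. int_scale (k P) (supp P)) = supp (msum C A) - supp (msum D B)"
      unfolding sum.insert[OF insert.hyps] AB(3) CD(3) supp_msum[OF CD(1) AB(1)] supp_msum[OF CD(2) AB(2)]
      by (simp add: algebra_simps)
    moreover have "(\<Sum>P\<in>insert P F. of_int (k P) * c P) = c (msum C A) - c (msum D B)"
      unfolding sum.insert[OF insert.hyps] AB(4) CD(4) dimfun_add[OF c(1) CD(1) AB(1)] dimfun_add[OF c(1) CD(2) AB(2)]
      by simp
    ultimately show ?case using msum_ipoly_zlat AB(1,2) CD(1,2) by blast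
  qed
  then obtain A B where AB: "ipoly_in zlat A" "ipoly_in zlat B" "(\<Sum>P\<in>F. int_scale (k P) (supp P)) = supp A - supp B"
    "(\<Sum>P\<in>F. of_int (k P) * c P) = c A - c B" by blast
  obtain v where v: "v \<in> zlat" "supp A - supp B = lin v" using rel AB(3) by (auto simp: lattice_lin_def)
  have "supp A = supp (msum B {v})"
    unfolding supp_msum[OF AB(2) ipoly_in_sing[OF v(1)]] supp_sing v(2)[symmetric] by simp
  then have "A = (\<lambda>x. x + v) ` B"
    using supp_inject[OF AB(1) msum_ipoly_zlat[OF AB(2) ipoly_in_sing[OF v(1)]]] by (simp add: msum_sing)
  then have "c A = c B" using dimfun_translate[OF c(1) AB(2) v(1) c(2)] by simp
  then show ?thesis using AB(4) by simp
qed

text \<open>A single choice for all rational subspaces: every pure subgroup draws on the same local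
  bases.\<close>

locale basis_choice =
  fixes BB :: "(real^'n::finite) set \<Rightarrow> (real^'n) set set"
  assumes BB: "\<And>U. ratsub U \<Longrightarrow> dim U \<ge> 1 \<Longrightarrow> local_basis U (BB U)"
begin

definition bpolys :: "nat \<Rightarrow> (real^'n) set \<Rightarrow> (real^'n) set set" where
  "bpolys m V = {P. \<exists>U. ratsub U \<and> 1 \<le> dim U \<and> dim U \<le> m \<and> U \<subseteq> V \<and> P \<in> BB U}"

definition bclasses :: "nat \<Rightarrow> 'n pcls set" where
  "bclasses m = (\<lambda>P. tcls P {0}) ` bpolys m UNIV"

lemma BB_poly:
  assumes "ratsub U" "dim U \<ge> 1" "P \<in> BB U"
  shows "ipoly_in (U \<inter> zlat) P" "ipoly_in zlat P" "aff_dim P = int (dim U)" "par P U" "dirspace P = U"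
proof -
  show 1: "ipoly_in (U \<inter> zlat) P" and 2: "aff_dim P = int (dim U)"
    using BB[OF assms(1,2)] assms(3) by (auto simp: local_basis_def)
  show "ipoly_in zlat P" using 1 by (rule ipoly_in_mono) auto
  show par: "par P U" using 1 assms(1) by (intro par_ipoly_in[of U "U \<inter> zlat"]) (auto simp: ratsub_def)
  show "dirspace P = U"
    using ratsub_subspace[OF assms(1)] par ipoly_in_nonempty[OF 1] 2 by (rule dirspace_eq)
qed

lemma bpolys_zlat: "P \<in> bpolys m V \<Longrightarrow> ipoly_in zlat P"
  by (auto simp: bpolys_def dest: BB_poly)

text \<open>A relation is tested against the functional dual to one of its polytopes of maximal dimension.\<close>

lemma indep_bpolys: "indep_mod lattice_lin supp (bpolys m V)"
  unfolding indep_mod_def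
proof (intro allI impI)
  fix F and k :: "(real^'n) set \<Rightarrow> int"
  assume F: "finite F" "F \<subseteq> bpolys m V" and rel: "(\<Sum>P\<in>F. int_scale (k P) (supp P)) \<in> lattice_lin"
  show "\<forall>P\<in>F. k P = 0"
  proof (rule ccontr)
    assume "\<not> (\<forall>P\<in>F. k P = 0)"
    define M where "M = (\<lambda>P. dim (dirspace P)) ` {P \<in> F. k P \<noteq> 0}"
    have M: "finite M" "M \<noteq> {}" using F(1) \<open>\<not> (\<forall>P\<in>F. k P = 0)\<close> by (auto simp: M_def)
    obtain P where P: "P \<in> F" "k P \<noteq> 0" "dim (dirspace P) = Max M" using Max_in[OF M] by (auto simp: M_def)
    have max: "dim (dirspace Q) \<le> dim (dirspace P)" if "Q \<in> F" "k Q \<noteq> 0" for Q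
      unfolding P(3) using M(1) that by (intro Max_ge) (auto simp: M_def)
    obtain U where U: "ratsub U" "dim U \<ge> 1" "P \<in> BB U" using P(1) F(2) by (auto simp: bpolys_def)
    obtain c where c: "dimfun U c" "c P = 1" "\<forall>Q\<in>BB U. Q \<noteq> P \<longrightarrow> c Q = 0"
      using BB[OF U(1,2)] U(3) by (auto simp: local_basis_def)
    have other: "of_int (k Q) * c Q = 0" if Q: "Q \<in> F" "Q \<noteq> P" for Q
    proof (cases "k Q = 0")
      case False
      obtain U' where U': "ratsub U'" "dim U' \<ge> 1" "Q \<in> BB U'" using Q(1) F(2) by (auto simp: bpolys_def)
      have "dim U' \<le> dim U" using max[OF Q(1) False] BB_poly(5)[OF U] BB_poly(5)[OF U'] by simp
      \<comment> \<open>With direction space U the value vanishes by duality; any other direction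
        space of dimension at most \<open>dim U\<close> is invisible to c.\<close>
      then have "c Q = 0"
        using c(3) Q(2) U'(3) dimfun_other[OF c(1) BB_poly(2)[OF U'] BB_poly(4)[OF U'] ratsub_subspace[OF U(1)] ratsub_subspace[OF U'(1)]]
        by (cases "U' = U") auto
      then show ?thesis by simp
    qed simp
    have "0 = (\<Sum>Q\<in>F. of_int (k Q) * c Q)"
      using F bpolys_zlat by (intro dimfun_relation[OF c(1) U(2) F(1) _ rel, symmetric]) auto
    also have "\<dots> = of_int (k P) * c P + (\<Sum>Q\<in>F - {P}. of_int (k Q) * c Q)" using F(1) P(1) by (rule sum.remove)
    also have "(\<Sum>Q\<in>F - {P}. of_int (k Q) * c Q) = 0" using other by (intro sum.neutral) auto
    finally show False using c(2) P(2) by simp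
  qed
qed

text \<open>Induction on dimension. A polytope of dimension m + 1 is moved into its direction space,
  which is rational and contained in V even if V is not rational; the local basis there leaves only
  smaller dimension.\<close>

lemma supp_in_span:
  assumes V: "subspace V" and P: "ipoly_in (V \<inter> zlat) P" "aff_dim P \<le> int m"
  shows "supp P \<in> zm.span (lattice_lin \<union> supp ` bpolys m V)"
  using P
proof (induction m arbitrary: P)
  case 0
  have "aff_dim P = 0" using 0 aff_dim_negative_iff[of P] ipoly_in_nonempty[OF 0(1)] by linarith
  then obtain v where v: "P = {v}" by (auto simp: aff_dim_eq_0)
  obtain S where "S \<noteq> {}" "S \<subseteq> V \<inter> zlat" "P = convex hull S" using 0(1) by (rule ipoly_inE)
  then have "v \<in> zlat" using v hull_subset[of S convex] by auto
  then show ?case unfolding v supp_sing by (intro zm.span_base) (auto simp: lattice_lin_def)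
next
  case (Suc m)
  let ?W = "zm.span (lattice_lin \<union> supp ` bpolys (Suc m) V)"
  have "bpolys m V \<subseteq> bpolys (Suc m) V" by (auto simp: bpolys_def)
  then have mono: "zm.span (lattice_lin \<union> supp ` bpolys m V) \<subseteq> ?W" by (intro zm.span_mono) auto
  show ?case
  proof (cases "aff_dim P \<le> int m")
    case True
    then show ?thesis using Suc.IH[OF Suc.prems(1)] mono by blast
  next
    case False
    let ?D = "dirspace P"
    obtain a where a: "a \<in> V \<inter> zlat" and Q: "ipoly_in (?D \<inter> zlat) ((\<lambda>x. x + (- a)) ` P)"
      "supp P = supp ((\<lambda>x. x + (- a)) ` P) + lin a" and D: "ratsub ?D"
      using ipoly_in_dirspace[OF Suc.prems(1)] by blast
    have Ddim: "dim ?D = Suc m"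
      using False Suc.prems dim_dirspace[OF ipoly_in_nonempty[OF Suc.prems(1)]] by simp
    have DV: "?D \<subseteq> V" using V Suc.prems(1) by (intro dirspace_minimal par_ipoly_in[of V "V \<inter> zlat"]) auto
    have "supp ((\<lambda>x. x + (- a)) ` P) \<in> zm.span (lowsupp (?D \<inter> zlat) (dim ?D) \<union> supp ` BB ?D)"
      using BB[OF D] Ddim Q(1) by (auto simp: local_basis_def)
    moreover have "zm.span (lowsupp (?D \<inter> zlat) (dim ?D) \<union> supp ` BB ?D) \<subseteq> ?W"
    proof (intro zm.span_minimal zm.subspace_span Un_least)
      show "lowsupp (?D \<inter> zlat) (dim ?D) \<subseteq> ?W"
      proof
        fix f assume "f \<in> lowsupp (?D \<inter> zlat) (dim ?D)"
        then obtain R where R: "f = supp R" "ipoly_in (?D \<inter> zlat) R" "aff_dim R \<le> int m"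
          using Ddim by (auto simp: lowsupp_def)
        have "ipoly_in (V \<inter> zlat) R" using R(2) by (rule ipoly_in_mono) (use DV in auto)
        then show "f \<in> ?W" using Suc.IH R mono by blast
      qed
      have "BB ?D \<subseteq> bpolys (Suc m) V" using D Ddim DV by (auto simp: bpolys_def)
      then show "supp ` BB ?D \<subseteq> ?W" by (auto intro: zm.span_base)
    qed
    ultimately have "supp ((\<lambda>x. x + (- a)) ` P) \<in> ?W" by blast
    moreover have "lin a \<in> ?W" using a by (intro zm.span_base) (auto simp: lattice_lin_def)
    ultimately show ?thesis unfolding Q(2) by (rule zm.span_add)
  qed
qed

lemma virt_bclass:
  assumes "P \<in> bpolys m V"
  shows "virt (tcls P {0}) - supp P \<in> lattice_lin"
  using virt_tcls[OF bpolys_zlat[OF assms] ipoly_in_0] by (simp add: supp_0)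

text \<open>A basis polytope is chosen for each class; its support function differs from the value
  of the class by a lattice functional.\<close>

lemma indep_bclasses: "indep_mod lattice_lin virt (bclasses m)"
proof -
  define f where "f = inv_into (bpolys m UNIV) (\<lambda>P. tcls P {0})"
  have f: "f b \<in> bpolys m UNIV" "tcls (f b) {0} = b" if "b \<in> bclasses m" for b
    using inv_into_into[OF that[unfolded bclasses_def]] f_inv_into_f[OF that[unfolded bclasses_def]]
    by (simp_all only: f_def)
  show ?thesis
  proof (rule indep_mod_image[OF subspace_lattice_lin indep_bpolys])
    show "inj_on f (bclasses m)" unfolding f_def bclasses_def by (rule inj_on_inv_into) simp
    show "f ` bclasses m \<subseteq> bpolys m UNIV" using f(1) by blast
    show "virt b - supp (f b) \<in> lattice_lin" if "b \<in> bclasses m" for b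
      using virt_bclass[OF f(1)[OF that]] f(2)[OF that] by simp
  qed
qed

lemma bclasses_carrier: "bclasses m \<subseteq> carrier PTgrp"
  by (auto simp: bclasses_def intro!: tcls_in_carrier ipoly_in_0 bpolys_zlat)

text \<open>If the class is that of P' - Q' with both in V, then P + Q' is a translate of P', so P
  is parallel to V and its direction space lies in V. This is why intersecting with
  \<open>PT_sub\<close> selects the local bases of the rational subspaces inside V.\<close>

lemma bclasses_PT_sub:
  assumes V: "subspace V" and P: "P \<in> bpolys m UNIV" and b: "tcls P {0} \<in> PT_sub (V \<inter> zlat)"
  shows "P \<in> bpolys m V"
proof -
  obtain U where U: "ratsub U" "1 \<le> dim U" "dim U \<le> m" "P \<in> BB U" using P by (auto simp: bpolys_def)
  note PU = BB_poly[OF U(1,2,4)]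
  obtain P' Q' where PQ: "ipoly_in (V \<inter> zlat) P'" "ipoly_in (V \<inter> zlat) Q'" "tcls P {0} = tcls P' Q'"
    using b by (auto simp: PT_sub_def)
  have PQz: "ipoly_in zlat P'" "ipoly_in zlat Q'" using PQ(1,2) by (auto intro: ipoly_in_mono)
  have "(P', Q') \<in> tcls P' Q'"
    unfolding tcls_def using PQz by (auto intro!: bexI[of _ 0])
  then have "(P', Q') \<in> tcls P {0}" using PQ(3) by simp
  then obtain h where h: "msum P Q' = (\<lambda>x. x + h) ` msum P' {0}" by (auto simp: tcls_def)
  then have eq: "msum P Q' = (\<lambda>x. x + h) ` P'" by (simp add: msum_sing)
  obtain q where q: "q \<in> Q'" using ipoly_in_nonempty[OF PQ(2)] by blast
  have "par P' V" using V PQ(1) by (intro par_ipoly_in[of V "V \<inter> zlat"]) auto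
  then have "par (msum P Q') V" unfolding eq par_translate .
  then have "par P V"
    unfolding par_def using q by (auto simp: msum_def) (metis add_diff_cancel_right)
  then have "U \<subseteq> V" using dirspace_minimal[OF V] PU(5) by blast
  then show ?thesis using U by (auto simp: bpolys_def)
qed

lemma supp_in_virt_span:
  assumes V: "subspace V" and P: "ipoly_in (V \<inter> zlat) P" "aff_dim P \<le> int m"
  shows "supp P \<in> zm.span (lattice_lin \<union> virt ` (bclasses m \<inter> PT_sub (V \<inter> zlat)))"
    (is "_ \<in> ?W")
proof -
  have "supp ` bpolys m V \<subseteq> ?W"
  proof
    fix f assume "f \<in> supp ` bpolys m V"
    then obtain P where P: "P \<in> bpolys m V" "f = supp P" by blast
    then obtain U where U: "ratsub U" "1 \<le> dim U" "dim U \<le> m" "U \<subseteq> V" "P \<in> BB U" by (auto simp: bpolys_def)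
    have "ipoly_in (V \<inter> zlat) P" using BB_poly(1)[OF U(1,2,5)] by (rule ipoly_in_mono) (use U in auto)
    moreover have "ipoly_in (V \<inter> zlat) {0}" using V by (intro ipoly_in_sing) (simp add: subspace_0)
    ultimately have "tcls P {0} \<in> PT_sub (V \<inter> zlat)" by (auto simp: PT_sub_def)
    moreover have "tcls P {0} \<in> bclasses m" using P(1) by (auto simp: bclasses_def bpolys_def)
    ultimately have "virt (tcls P {0}) \<in> ?W" by (intro zm.span_base) auto
    moreover have "virt (tcls P {0}) - supp P \<in> ?W" using virt_bclass[OF P(1)] by (intro zm.span_base) auto
    ultimately have "virt (tcls P {0}) - (virt (tcls P {0}) - supp P) \<in> ?W" by (rule zm.span_diff)
    moreover have "virt (tcls P {0}) - (virt (tcls P {0}) - supp P) = f" by (simp add: P(2))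
    ultimately show "f \<in> ?W" by (simp only:)
  qed
  moreover have "lattice_lin \<subseteq> ?W" by (auto intro: zm.span_base)
  ultimately have "zm.span (lattice_lin \<union> supp ` bpolys m V) \<subseteq> ?W"
    by (intro zm.span_minimal zm.subspace_span Un_least)
  then show ?thesis using supp_in_span[OF V P] by blast
qed

section \<open>The basis statements for the filtration, for P_T and for P\<close>

lemma zbasis_PT_m:
  assumes V: "subspace V"
  shows "zbasis PTgrp (PT_m (V \<inter> zlat) m) (bclasses m \<inter> PT_sub (V \<inter> zlat))"
proof (rule PT.zbasisI)
  let ?G = "V \<inter> zlat"
  let ?gen = "{tcls P {0} | P. ipoly_in ?G P \<and> aff_dim P \<le> int m}"
  let ?W = "zm.span (lattice_lin \<union> virt ` (bclasses m \<inter> PT_sub ?G))"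
  have G: "ipoly_in zlat P" if "ipoly_in ?G P" for P :: "(real^'n) set"
    using that by (rule ipoly_in_mono) auto
  have gen: "?gen \<subseteq> carrier PTgrp" using G by (auto intro!: tcls_in_carrier ipoly_in_0)
  show "PT_m ?G m \<subseteq> carrier PTgrp" unfolding PT_m_def using gen by (rule PT.generate_incl)
  show "bclasses m \<inter> PT_sub ?G \<subseteq> PT_m ?G m"
  proof
    fix b assume "b \<in> bclasses m \<inter> PT_sub ?G"
    then obtain P where P: "P \<in> bpolys m V" "b = tcls P {0}"
      using bclasses_PT_sub[OF V] by (auto simp: bclasses_def)
    then obtain U where U: "ratsub U" "1 \<le> dim U" "dim U \<le> m" "U \<subseteq> V" "P \<in> BB U" by (auto simp: bpolys_def)
    note PU = BB_poly[OF U(1,2,5)]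
    have "ipoly_in ?G P" using PU(1) by (rule ipoly_in_mono) (use U in auto)
    then have "b \<in> ?gen" using P(2) PU(3) U(3) by auto
    then show "b \<in> PT_m ?G m" unfolding PT_m_def by (rule generate.incl)
  qed
  have lin_W: "f \<in> ?W" if "f \<in> lattice_lin" for f using that by (intro zm.span_base) auto
  show "indep_mod lattice_lin virt (bclasses m \<inter> PT_sub ?G)"
    using indep_bclasses by (rule indep_mod_mono) auto
  have gen_W: "virt x \<in> ?W" if x: "x \<in> ?gen" for x
  proof -
    obtain P where P: "x = tcls P {0}" "ipoly_in ?G P" "aff_dim P \<le> int m" using x by blast
    have "virt (tcls P {0}) - supp P \<in> ?W"
      using virt_tcls[OF G[OF P(2)] ipoly_in_0] by (intro lin_W) (simp add: supp_0)
    then have "(virt (tcls P {0}) - supp P) + supp P \<in> ?W"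
      using supp_in_virt_span[OF V P(2,3)] by (rule zm.span_add)
    then show ?thesis by (simp only: P(1) diff_add_cancel)
  qed
  fix x assume "x \<in> PT_m ?G m"
  then have "x \<in> generate PTgrp ?gen" by (simp only: PT_m_def)
  \<comment> \<open>\<open>virt\<close> respects unit, inverses and products modulo lattice
    functionals, which lie in the span, so generators suffice.\<close>
  then show "virt x \<in> ?W"
  proof (induction rule: generate.induct)
    case one
    show ?case using PT.model_one by (rule lin_W)
  next
    case (incl h)
    then show ?case by (rule gen_W)
  next
    case (inv h)
    have "virt (inv\<^bsub>PTgrp\<^esub> h) + virt h \<in> ?W" using gen inv by (intro lin_W PT.model_inv) auto
    then have "(virt (inv\<^bsub>PTgrp\<^esub> h) + virt h) - virt h \<in> ?W" using gen_W[OF inv] by (rule zm.span_diff)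
    then show ?case by (simp only: add_diff_cancel_right')
  next
    case (eng h1 h2)
    have "h1 \<in> carrier PTgrp" "h2 \<in> carrier PTgrp" using eng.hyps PT.generate_incl[OF gen] by blast+
    then have "virt (h1 \<otimes>\<^bsub>PTgrp\<^esub> h2) - (virt h1 + virt h2) \<in> ?W" by (intro lin_W PT.model_mult)
    moreover have "virt h1 + virt h2 \<in> ?W" using eng.IH by (rule zm.span_add)
    ultimately have "(virt (h1 \<otimes>\<^bsub>PTgrp\<^esub> h2) - (virt h1 + virt h2)) + (virt h1 + virt h2) \<in> ?W" by (rule zm.span_add)
    then show ?case by (simp only: diff_add_cancel)
  qed
qed

lemma virt_in_span:
  assumes "x \<in> carrier PTgrp"
  shows "virt x \<in> zm.span (lattice_lin \<union> virt ` bclasses CARD('n))"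
proof -
  let ?W = "zm.span (lattice_lin \<union> virt ` bclasses CARD('n))"
  obtain P Q where PQ: "x = tcls P Q" "ipoly_in zlat P" "ipoly_in zlat Q" using assms by (auto simp: PTgrp_def)
  have sub: "zm.span (lattice_lin \<union> virt ` (bclasses CARD('n) \<inter> PT_sub (UNIV \<inter> zlat))) \<subseteq> ?W"
    by (intro zm.span_mono) auto
  have supp: "supp R \<in> ?W" if "ipoly_in zlat R" for R
    using supp_in_virt_span[of UNIV R "CARD('n)"] sub that aff_dim_le_DIM[of R] by auto
  have "virt x - (supp P - supp Q) \<in> ?W"
    unfolding PQ(1) using virt_tcls[OF PQ(2,3)] by (intro zm.span_base) auto
  then have "(virt x - (supp P - supp Q)) + (supp P - supp Q) \<in> ?W"
    by (rule zm.span_add[OF _ zm.span_diff[OF supp[OF PQ(2)] supp[OF PQ(3)]]])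
  then show ?thesis by (simp only: diff_add_cancel)
qed

lemma zbasis_PTgrp: "zbasis PTgrp (carrier PTgrp) (bclasses CARD('n))"
  using bclasses_carrier indep_bclasses virt_in_span by (intro PT.zbasisI) auto

text \<open>The middle term of the exact sequence H -> P -> P_T: modulo lattice functionals the
  points vanish, which settles the coefficients on B', and what remains is a relation among points.
  Generation is lifted in the same way.\<close>

lemma zbasis_Pgrp:
  assumes A: "zbasis Zgrp zlat A" and B': "B' \<subseteq> carrier Pgrp" "bij_betw proj_T B' (bclasses CARD('n))"
  shows "zbasis Pgrp (carrier Pgrp) ((\<lambda>a. gcls {a} {0}) ` A \<union> B')"
proof (rule PP.zbasisI)
  let ?A = "(\<lambda>a. gcls {a} {0}) ` A"
  have Az: "A \<subseteq> zlat" using A by (auto simp: zbasis_def)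
  have virt_A: "virt (gcls {a} {0}) = lin a" if "a \<in> A" for a
    using that Az by (subst virt_gcls) (auto simp: supp_sing lin_0 intro!: ipoly_in_sing)
  have zlat: "zlat \<subseteq> carrier Zgrp" "\<one>\<^bsub>Zgrp\<^esub> \<in> (zlat :: (real^'n) set)" by (auto simp: Zgrp_def)
  have "gcls {a} {0} \<in> carrier Pgrp" if "a \<in> A" for a
  proof -
    have "ipoly_in zlat {a}" using that Az by (intro ipoly_in_sing) auto
    then show ?thesis using ipoly_in_0 by (auto simp: Pgrp_def)
  qed
  then show "?A \<union> B' \<subseteq> carrier Pgrp" using B'(1) by blast
  have projB: "proj_T b \<in> bclasses CARD('n)" "virt (proj_T b) - virt b \<in> lattice_lin" if "b \<in> B'" for b
    using that B' proj_T(2) by (auto simp: bij_betw_def)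
  have indB: "indep_mod lattice_lin virt B'"
  proof (rule indep_mod_image[OF subspace_lattice_lin indep_bclasses])
    show "inj_on proj_T B'" "proj_T ` B' \<subseteq> bclasses CARD('n)" using B'(2) by (auto simp: bij_betw_def)
    show "virt b - virt (proj_T b) \<in> lattice_lin" if "b \<in> B'" for b
      using zm.subspace_neg[OF subspace_lattice_lin projB(2)[OF that]] by simp
  qed
  have indA: "indep_mod {0} virt ?A"
  proof -
    define f where "f = inv_into A (\<lambda>a. gcls {a} {0})"
    have f: "f x \<in> A" "gcls {f x} {0} = x" if "x \<in> ?A" for x
      using inv_into_into[OF that] f_inv_into_f[OF that] by (simp_all only: f_def)
    show ?thesis
    proof (rule indep_mod_image[OF subspace_zero ZZ.zbasis_indep[OF A zlat]])
      show "inj_on f ?A" unfolding f_def by (rule inj_on_inv_into) simp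
      show "f ` ?A \<subseteq> A" using f(1) by blast
      show "virt x - lin (f x) \<in> {0}" if "x \<in> ?A" for x
        using virt_A[OF f(1)[OF that]] f(2)[OF that] by simp
    qed
  qed
  show "indep_mod {0} virt (?A \<union> B')"
    unfolding indep_mod_def
  proof (intro allI impI ballI)
    fix F and c :: "'n pcls \<Rightarrow> int" and b
    assume F: "finite F" "F \<subseteq> ?A \<union> B'" and rel: "(\<Sum>b\<in>F. int_scale (c b) (virt b)) \<in> {0}" and b: "b \<in> F"
    \<comment> \<open>The split is by membership in B', so a class that is both a point and a lift
      is counted once.\<close>
    have split: "(\<Sum>b\<in>F. int_scale (c b) (virt b)) =
        (\<Sum>b\<in>F - B'. int_scale (c b) (virt b)) + (\<Sum>b\<in>F \<inter> B'. int_scale (c b) (virt b))"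
      by (subst sum.Int_Diff[OF F(1), of _ B']) (rule add.commute)
    have "(\<Sum>b\<in>F - B'. int_scale (c b) (virt b)) \<in> lattice_lin"
    proof (intro zm.subspace_sum zm.subspace_scale subspace_lattice_lin)
      fix x assume "x \<in> F - B'"
      then obtain a where "a \<in> A" "x = gcls {a} {0}" using F(2) by blast
      then show "virt x \<in> lattice_lin" using virt_A Az by (auto simp: lattice_lin_def)
    qed
    then have "- (\<Sum>b\<in>F - B'. int_scale (c b) (virt b)) \<in> lattice_lin"
      by (rule zm.subspace_neg[OF subspace_lattice_lin])
    also have "- (\<Sum>b\<in>F - B'. int_scale (c b) (virt b)) = (\<Sum>b\<in>F \<inter> B'. int_scale (c b) (virt b))"
      using rel unfolding split by (simp add: neg_eq_iff_add_eq_0)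
    finally have cB: "c x = 0" if "x \<in> F \<inter> B'" for x
      using that F(1) by (intro indep_modD[OF indB, of "F \<inter> B'" c x]) auto
    then have "(\<Sum>b\<in>F \<inter> B'. int_scale (c b) (virt b)) = 0"
      by (intro sum.neutral) (auto simp: zm.scale_zero_left)
    then have "(\<Sum>b\<in>F - B'. int_scale (c b) (virt b)) \<in> {0}" using rel unfolding split by simp
    then have "c x = 0" if "x \<in> F - B'" for x
      using that F by (intro indep_modD[OF indA, of "F - B'" c x]) auto
    then show "c b = 0" using cB b by blast
  qed
  let ?W = "zm.span ({0} \<union> virt ` (?A \<union> B'))"
  have lin_W: "f \<in> ?W" if "f \<in> lattice_lin" for f
  proof -
    obtain v where v: "f = lin v" "v \<in> zlat" using \<open>f \<in> lattice_lin\<close> unfolding lattice_lin_def by blast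
    have "lin v \<in> zm.span ({0} \<union> lin ` A)" using A zlat(1) v(2) by (rule ZZ.zbasis_span)
    moreover have "lin ` A \<subseteq> virt ` ?A"
    proof
      fix f assume "f \<in> lin ` A"
      then obtain a where a: "a \<in> A" "f = lin a" by blast
      have "f = virt (gcls {a} {0})" unfolding a(2) by (rule virt_A[OF a(1), symmetric])
      then show "f \<in> virt ` ?A" by (rule image_eqI) (rule imageI[OF a(1)])
    qed
    then have "zm.span ({0} \<union> lin ` A) \<subseteq> ?W" by (intro zm.span_mono) auto
    ultimately show ?thesis using v(1) by blast
  qed
  have B_W: "virt ` bclasses CARD('n) \<subseteq> ?W"
  proof
    fix f assume "f \<in> virt ` bclasses CARD('n)"
    then have "f \<in> virt ` proj_T ` B'" by (simp only: bij_betw_imp_surj_on[OF B'(2)])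
    then obtain b where b: "b \<in> B'" "f = virt (proj_T b)" by (elim imageE) simp
    have "virt b \<in> ?W" using b(1) by (intro zm.span_base) auto
    then have "(virt (proj_T b) - virt b) + virt b \<in> ?W"
      by (rule zm.span_add[OF lin_W[OF projB(2)[OF b(1)]]])
    then show "f \<in> ?W" by (simp only: b(2) diff_add_cancel)
  qed
  fix x :: "'n pcls" assume x: "x \<in> carrier Pgrp"
  have "zm.span (lattice_lin \<union> virt ` bclasses CARD('n)) \<subseteq> ?W"
    using lin_W B_W by (intro zm.span_minimal zm.subspace_span) auto
  then have "virt (proj_T x) \<in> ?W" using virt_in_span[OF proj_T(1)[OF x]] by blast
  then have "virt (proj_T x) - (virt (proj_T x) - virt x) \<in> ?W"
    using lin_W[OF proj_T(2)[OF x]] by (rule zm.span_diff)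
  moreover have "virt (proj_T x) - (virt (proj_T x) - virt x) = virt x" by simp
  ultimately show "virt x \<in> ?W" by (simp only:)
qed simp

end

theorem theorem4p3:
  "\<exists>B :: nat \<Rightarrow> 'n::finite pcls set.
     B 0 = {} \<and>
     (\<forall>m. 1 \<le> m \<and> m \<le> CARD('n) \<longrightarrow> B (m - 1) \<subseteq> B m) \<and>
     (\<forall>m. 1 \<le> m \<and> m \<le> CARD('n) \<longrightarrow> B m \<subseteq> carrier PTgrp) \<and>
     (\<forall>G m. pure_subgroup G \<and> 1 \<le> m \<and> m \<le> CARD('n) \<longrightarrow>
         zbasis PTgrp (PT_m G m) (B m \<inter> PT_sub G)) \<and>
     (\<forall>m. 1 \<le> m \<and> m \<le> CARD('n) \<longrightarrow>
         (\<forall>b\<in>B m - B (m - 1). \<exists>P. ipoly_in zlat P \<and> aff_dim P = int m \<and> b = tcls P {0})) \<and>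
     zbasis PTgrp (carrier PTgrp) (B (CARD('n))) \<and>
     (\<forall>A B'. zbasis Zgrp zlat A \<and> B' \<subseteq> carrier Pgrp \<and> bij_betw proj_T B' (B (CARD('n))) \<longrightarrow>
         zbasis Pgrp (carrier Pgrp) ((\<lambda>a. gcls {a} {0}) ` A \<union> B'))"
proof -
  obtain BB where "\<And>U :: (real^'n) set. ratsub U \<Longrightarrow> dim U \<ge> 1 \<Longrightarrow> local_basis U (BB U)"
    using local_basis_exists by metis
  then interpret basis_choice BB by unfold_locales
  show ?thesis
  proof (intro exI[of _ bclasses] conjI allI impI ballI; (elim conjE)?)
    show "bclasses 0 = {}" by (auto simp: bclasses_def bpolys_def simp del: dim_eq_0)
    show "bclasses (m - 1) \<subseteq> bclasses m" for m by (force simp: bclasses_def bpolys_def)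
    show "bclasses m \<subseteq> carrier PTgrp" for m by (rule bclasses_carrier)
    show "zbasis PTgrp (PT_m G m) (bclasses m \<inter> PT_sub G)" if "pure_subgroup G" "1 \<le> m" for G m
      using that zbasis_PT_m by (auto simp: pure_subgroup_def)
    show "\<exists>P. ipoly_in zlat P \<and> aff_dim P = int m \<and> b = tcls P {0}"
      if m: "1 \<le> m" and b: "b \<in> bclasses m - bclasses (m - 1)" for m b
    proof -
      obtain P U where U: "b = tcls P {0}" "ratsub U" "1 \<le> dim U" "dim U \<le> m" "P \<in> BB U"
        using b by (auto simp: bclasses_def bpolys_def)
      \<comment> \<open>A smaller direction space would put the class into the previous set
        already.\<close>
      have "\<not> dim U \<le> m - 1"
      proof
        assume "dim U \<le> m - 1"
        then have "P \<in> bpolys (m - 1) UNIV" using U by (auto simp: bpolys_def)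
        then show False using b U(1) by (auto simp: bclasses_def)
      qed
      then have "dim U = m" using U(4) by simp
      then show ?thesis using BB_poly(2,3)[OF U(2,3,5)] U(1) by blast
    qed
    show "zbasis PTgrp (carrier PTgrp) (bclasses CARD('n))" by (rule zbasis_PTgrp)
    show "zbasis Pgrp (carrier Pgrp) ((\<lambda>a. gcls {a} {0}) ` A \<union> B')"
      if "zbasis Zgrp zlat A" "B' \<subseteq> carrier Pgrp" "bij_betw proj_T B' (bclasses CARD('n))" for A B'
      using that by (rule zbasis_Pgrp)
  qed
qed

end
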